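(* Let $\mathcal{E}$ be an elementary topos that satisfies (NS) and (DQO), and for each object $X$ of $\mathcal{E}$ let $\Pi X$ be the decidable quotient of $X$ given by (DQO). Then $\Pi$ is the object part of a finite-product-preserving functor $\mathcal{E}\to\mathrm{Dec}(\mathcal{E})$ that is left adjoint to the inclusion $\mathrm{Dec}(\mathcal{E})\hookrightarrow\mathcal{E}$.
   Context: An object $X$ of a topos $\mathcal{E}$ is decidable if its diagonal $X\rightarrowtail X\times X$ is a complemented subobject. $\mathrm{Dec}(\mathcal{E})$ is the full subcategory of $\mathcal{E}$ on the decidable objects. $2$ denotes $1+1$. (NS): any object of $\mathcal{E}$ is either initial or has a global element (an arrow from the terminal object $1$). (DQO): for every object $X$ there exists a unique (up to isomorphism under $X$) decidable quotient of $X$, i.e. an epimorphism $p_X:X\twoheadrightarrow \Pi X$ with $\Pi X$ decidable, along which any arrow $X\to 2$ factors uniquely. *)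

theory Defs
  imports Main
begin

section \<open>Categories\<close>

record ('o, 'm) category_data =
  Obj :: "'o set"
  Arr :: "'m set"
  Dom :: "'m \<Rightarrow> 'o"
  Cod :: "'m \<Rightarrow> 'o"
  Id :: "'o \<Rightarrow> 'm"
  Comp :: "'m \<Rightarrow> 'm \<Rightarrow> 'm" (infixl "\<cdot>\<index>" 70)

text \<open>Composition is in applicative order: \<open>g \<cdot>\<^bsub>C\<^esub> f\<close> is \<open>g\<close> after \<open>f\<close>.\<close>

definition hom :: "('o, 'm) category_data \<Rightarrow> 'o \<Rightarrow> 'o \<Rightarrow> 'm set" where
  "hom C X Y = {f \<in> Arr C. Dom C f = X \<and> Cod C f = Y}"

locale category =
  fixes C :: "('o, 'm) category_data" (structure)
  assumes Dom_in_Obj: "f \<in> Arr C \<Longrightarrow> Dom C f \<in> Obj C"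
    and Cod_in_Obj: "f \<in> Arr C \<Longrightarrow> Cod C f \<in> Obj C"
    and Id_in_hom: "X \<in> Obj C \<Longrightarrow> Id C X \<in> hom C X X"
    and Comp_in_hom: "f \<in> hom C X Y \<Longrightarrow> g \<in> hom C Y Z \<Longrightarrow> g \<cdot> f \<in> hom C X Z"
    and Comp_Id: "f \<in> hom C X Y \<Longrightarrow> f \<cdot> Id C X = f"
    and Id_Comp: "f \<in> hom C X Y \<Longrightarrow> Id C Y \<cdot> f = f"
    and Comp_assoc:
      "f \<in> hom C W X \<Longrightarrow> g \<in> hom C X Y \<Longrightarrow> h \<in> hom C Y Z \<Longrightarrow> (h \<cdot> g) \<cdot> f = h \<cdot> (g \<cdot> f)"

definition full_subcategory :: "('o, 'm) category_data \<Rightarrow> ('o \<Rightarrow> bool) \<Rightarrow> ('o, 'm) category_data" where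
  "full_subcategory C P =
     C\<lparr>Obj := {X \<in> Obj C. P X}, Arr := {f \<in> Arr C. P (Dom C f) \<and> P (Cod C f)}\<rparr>"

definition is_mono :: "('o, 'm) category_data \<Rightarrow> 'm \<Rightarrow> bool" where
  "is_mono C m \<longleftrightarrow> m \<in> Arr C \<and>
     (\<forall>W. \<forall>f \<in> hom C W (Dom C m). \<forall>g \<in> hom C W (Dom C m). m \<cdot>\<^bsub>C\<^esub> f = m \<cdot>\<^bsub>C\<^esub> g \<longrightarrow> f = g)"

definition is_epi :: "('o, 'm) category_data \<Rightarrow> 'm \<Rightarrow> bool" where
  "is_epi C e \<longleftrightarrow> e \<in> Arr C \<and>
     (\<forall>Z. \<forall>f \<in> hom C (Cod C e) Z. \<forall>g \<in> hom C (Cod C e) Z. f \<cdot>\<^bsub>C\<^esub> e = g \<cdot>\<^bsub>C\<^esub> e \<longrightarrow> f = g)"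

definition is_iso :: "('o, 'm) category_data \<Rightarrow> 'm \<Rightarrow> bool" where
  "is_iso C f \<longleftrightarrow> f \<in> Arr C \<and>
     (\<exists>g \<in> hom C (Cod C f) (Dom C f). g \<cdot>\<^bsub>C\<^esub> f = Id C (Dom C f) \<and> f \<cdot>\<^bsub>C\<^esub> g = Id C (Cod C f))"


section \<open>Limits and colimits\<close>

definition is_terminal :: "('o, 'm) category_data \<Rightarrow> 'o \<Rightarrow> bool" where
  "is_terminal C T \<longleftrightarrow> T \<in> Obj C \<and> (\<forall>X \<in> Obj C. \<exists>!f. f \<in> hom C X T)"

definition is_initial :: "('o, 'm) category_data \<Rightarrow> 'o \<Rightarrow> bool" where
  "is_initial C I \<longleftrightarrow> I \<in> Obj C \<and> (\<forall>X \<in> Obj C. \<exists>!f. f \<in> hom C I X)"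

definition is_binary_product ::
  "('o, 'm) category_data \<Rightarrow> 'o \<Rightarrow> 'o \<Rightarrow> 'o \<Rightarrow> 'm \<Rightarrow> 'm \<Rightarrow> bool" where
  "is_binary_product C X Y P p q \<longleftrightarrow>
     p \<in> hom C P X \<and> q \<in> hom C P Y \<and>
     (\<forall>W. \<forall>f \<in> hom C W X. \<forall>g \<in> hom C W Y.
        \<exists>!h. h \<in> hom C W P \<and> p \<cdot>\<^bsub>C\<^esub> h = f \<and> q \<cdot>\<^bsub>C\<^esub> h = g)"

definition is_binary_coproduct ::
  "('o, 'm) category_data \<Rightarrow> 'o \<Rightarrow> 'o \<Rightarrow> 'o \<Rightarrow> 'm \<Rightarrow> 'm \<Rightarrow> bool" where
  "is_binary_coproduct C X Y S i j \<longleftrightarrow>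
     i \<in> hom C X S \<and> j \<in> hom C Y S \<and>
     (\<forall>Z. \<forall>f \<in> hom C X Z. \<forall>g \<in> hom C Y Z.
        \<exists>!h. h \<in> hom C S Z \<and> h \<cdot>\<^bsub>C\<^esub> i = f \<and> h \<cdot>\<^bsub>C\<^esub> j = g)"

text \<open>The product of the family \<open>X 0, \<dots>, X (n - 1)\<close>; for \<open>n = 0\<close> this says that \<open>P\<close> is terminal.
  Values of \<open>X\<close> and \<open>\<pi>\<close> at indices \<open>\<ge> n\<close> are irrelevant.\<close>

definition is_finite_product ::
  "('o, 'm) category_data \<Rightarrow> nat \<Rightarrow> (nat \<Rightarrow> 'o) \<Rightarrow> 'o \<Rightarrow> (nat \<Rightarrow> 'm) \<Rightarrow> bool" where
  "is_finite_product C n X P \<pi> \<longleftrightarrow>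
     P \<in> Obj C \<and> (\<forall>i<n. \<pi> i \<in> hom C P (X i)) \<and>
     (\<forall>W \<in> Obj C. \<forall>f. (\<forall>i<n. f i \<in> hom C W (X i)) \<longrightarrow>
        (\<exists>!h. h \<in> hom C W P \<and> (\<forall>i<n. \<pi> i \<cdot>\<^bsub>C\<^esub> h = f i)))"

definition is_pullback ::
  "('o, 'm) category_data \<Rightarrow> 'm \<Rightarrow> 'm \<Rightarrow> 'o \<Rightarrow> 'm \<Rightarrow> 'm \<Rightarrow> bool" where
  "is_pullback C f g P p q \<longleftrightarrow>
     f \<in> Arr C \<and> g \<in> Arr C \<and> Cod C f = Cod C g \<and>
     p \<in> hom C P (Dom C f) \<and> q \<in> hom C P (Dom C g) \<and> f \<cdot>\<^bsub>C\<^esub> p = g \<cdot>\<^bsub>C\<^esub> q \<and>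
     (\<forall>W. \<forall>a \<in> hom C W (Dom C f). \<forall>b \<in> hom C W (Dom C g). f \<cdot>\<^bsub>C\<^esub> a = g \<cdot>\<^bsub>C\<^esub> b \<longrightarrow>
        (\<exists>!h. h \<in> hom C W P \<and> p \<cdot>\<^bsub>C\<^esub> h = a \<and> q \<cdot>\<^bsub>C\<^esub> h = b))"


section \<open>Elementary toposes\<close>

definition has_finite_limits :: "('o, 'm) category_data \<Rightarrow> bool" where
  "has_finite_limits C \<longleftrightarrow>
     (\<exists>T. is_terminal C T) \<and>
     (\<forall>f \<in> Arr C. \<forall>g \<in> Arr C. Cod C f = Cod C g \<longrightarrow> (\<exists>P p q. is_pullback C f g P p q))"

text \<open>\<open>E\<close> is the exponential \<open>Y\<^sup>X\<close>, with evaluation \<open>ev\<close> defined on a product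
  \<open>P\<close> of \<open>E\<close> and \<open>X\<close>. The arrow \<open>t\<close> below is \<open>g \<times> X : W \<times> X \<rightarrow> E \<times> X\<close>.\<close>

definition is_exponential ::
  "('o, 'm) category_data \<Rightarrow> 'o \<Rightarrow> 'o \<Rightarrow> 'o \<Rightarrow> 'o \<Rightarrow> 'm \<Rightarrow> 'm \<Rightarrow> 'm \<Rightarrow> bool" where
  "is_exponential C X Y E P p q ev \<longleftrightarrow>
     is_binary_product C E X P p q \<and> ev \<in> hom C P Y \<and>
     (\<forall>W Q r s. is_binary_product C W X Q r s \<longrightarrow> (\<forall>f \<in> hom C Q Y.
        \<exists>!g. g \<in> hom C W E \<and>
          (\<exists>t \<in> hom C Q P. p \<cdot>\<^bsub>C\<^esub> t = g \<cdot>\<^bsub>C\<^esub> r \<and> q \<cdot>\<^bsub>C\<^esub> t = s \<and> ev \<cdot>\<^bsub>C\<^esub> t = f)))"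

definition has_exponentials :: "('o, 'm) category_data \<Rightarrow> bool" where
  "has_exponentials C \<longleftrightarrow>
     (\<forall>X \<in> Obj C. \<forall>Y \<in> Obj C. \<exists>E P p q ev. is_exponential C X Y E P p q ev)"

definition is_subobject_classifier :: "('o, 'm) category_data \<Rightarrow> 'o \<Rightarrow> 'o \<Rightarrow> 'm \<Rightarrow> bool" where
  "is_subobject_classifier C T \<Omega> tr \<longleftrightarrow>
     is_terminal C T \<and> tr \<in> hom C T \<Omega> \<and>
     (\<forall>m. is_mono C m \<longrightarrow>
        (\<exists>!\<chi>. \<chi> \<in> hom C (Cod C m) \<Omega> \<and> (\<exists>u. is_pullback C \<chi> tr (Dom C m) m u)))"

definition elementary_topos :: "('o, 'm) category_data \<Rightarrow> bool" where
  "elementary_topos C \<longleftrightarrow>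
     category C \<and> has_finite_limits C \<and> has_exponentials C \<and>
     (\<exists>T \<Omega> tr. is_subobject_classifier C T \<Omega> tr)"


section \<open>Decidable objects\<close>

text \<open>Subobjects of \<open>X\<close> are represented by monomorphisms into \<open>X\<close>, preordered by \<open>sub_le\<close>.\<close>

definition monos_into :: "('o, 'm) category_data \<Rightarrow> 'o \<Rightarrow> 'm set" where
  "monos_into C X = {m. is_mono C m \<and> Cod C m = X}"

definition sub_le :: "('o, 'm) category_data \<Rightarrow> 'm \<Rightarrow> 'm \<Rightarrow> bool" where
  "sub_le C m n \<longleftrightarrow> (\<exists>h \<in> hom C (Dom C m) (Dom C n). n \<cdot>\<^bsub>C\<^esub> h = m)"

text \<open>A complement in the poset of subobjects of \<open>X\<close>: the meet of \<open>m\<close> and \<open>n\<close> is the least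
  subobject, and their join is the greatest one.\<close>

definition is_complement :: "('o, 'm) category_data \<Rightarrow> 'o \<Rightarrow> 'm \<Rightarrow> 'm \<Rightarrow> bool" where
  "is_complement C X m n \<longleftrightarrow>
     m \<in> monos_into C X \<and> n \<in> monos_into C X \<and>
     (\<forall>l \<in> monos_into C X. sub_le C l m \<and> sub_le C l n \<longrightarrow> (\<forall>k \<in> monos_into C X. sub_le C l k)) \<and>
     (\<forall>u \<in> monos_into C X. sub_le C m u \<and> sub_le C n u \<longrightarrow> (\<forall>k \<in> monos_into C X. sub_le C k u))"

definition decidable :: "('o, 'm) category_data \<Rightarrow> 'o \<Rightarrow> bool" where
  "decidable C X \<longleftrightarrow> X \<in> Obj C \<and>
     (\<exists>P p q d. is_binary_product C X X P p q \<and>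
        d \<in> hom C X P \<and> p \<cdot>\<^bsub>C\<^esub> d = Id C X \<and> q \<cdot>\<^bsub>C\<^esub> d = Id C X \<and>
        (\<exists>n. is_complement C P d n))"

definition Dec :: "('o, 'm) category_data \<Rightarrow> ('o, 'm) category_data" where
  "Dec C = full_subcategory C (decidable C)"


section \<open>The axioms (NS) and (DQO)\<close>

definition NS :: "('o, 'm) category_data \<Rightarrow> bool" where
  "NS C \<longleftrightarrow> (\<forall>X \<in> Obj C. is_initial C X \<or> (\<exists>T x. is_terminal C T \<and> x \<in> hom C T X))"

definition is_two :: "('o, 'm) category_data \<Rightarrow> 'o \<Rightarrow> bool" where
  "is_two C B \<longleftrightarrow> (\<exists>T i j. is_terminal C T \<and> is_binary_coproduct C T T B i j)"

text \<open>The quantification over \<open>B\<close> expresses independence of the choice of the coproduct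
  \<open>1 + 1\<close>, which exists in every elementary topos.\<close>

definition is_decidable_quotient :: "('o, 'm) category_data \<Rightarrow> 'o \<Rightarrow> 'o \<Rightarrow> 'm \<Rightarrow> bool" where
  "is_decidable_quotient C X S p \<longleftrightarrow>
     decidable C S \<and> p \<in> hom C X S \<and> is_epi C p \<and>
     (\<forall>B. is_two C B \<longrightarrow> (\<forall>f \<in> hom C X B. \<exists>!g. g \<in> hom C S B \<and> g \<cdot>\<^bsub>C\<^esub> p = f))"

definition DQO :: "('o, 'm) category_data \<Rightarrow> bool" where
  "DQO C \<longleftrightarrow> (\<forall>X \<in> Obj C.
     (\<exists>S p. is_decidable_quotient C X S p) \<and>
     (\<forall>S p S' p'. is_decidable_quotient C X S p \<and> is_decidable_quotient C X S' p' \<longrightarrow>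
        (\<exists>i \<in> hom C S S'. is_iso C i \<and> i \<cdot>\<^bsub>C\<^esub> p = p')))"


section \<open>Functors and adjunctions\<close>

definition is_functor ::
  "('o, 'm) category_data \<Rightarrow> ('p, 'n) category_data \<Rightarrow> ('o \<Rightarrow> 'p) \<Rightarrow> ('m \<Rightarrow> 'n) \<Rightarrow> bool" where
  "is_functor C D Fo Fa \<longleftrightarrow>
     category C \<and> category D \<and>
     (\<forall>X \<in> Obj C. Fo X \<in> Obj D) \<and>
     (\<forall>X Y. \<forall>f \<in> hom C X Y. Fa f \<in> hom D (Fo X) (Fo Y)) \<and>
     (\<forall>X \<in> Obj C. Fa (Id C X) = Id D (Fo X)) \<and>
     (\<forall>X Y Z. \<forall>f \<in> hom C X Y. \<forall>g \<in> hom C Y Z. Fa (g \<cdot>\<^bsub>C\<^esub> f) = Fa g \<cdot>\<^bsub>D\<^esub> Fa f)"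

definition preserves_finite_products ::
  "('o, 'm) category_data \<Rightarrow> ('p, 'n) category_data \<Rightarrow> ('o \<Rightarrow> 'p) \<Rightarrow> ('m \<Rightarrow> 'n) \<Rightarrow> bool" where
  "preserves_finite_products C D Fo Fa \<longleftrightarrow>
     (\<forall>n X P \<pi>. is_finite_product C n X P \<pi> \<longrightarrow>
        is_finite_product D n (\<lambda>i. Fo (X i)) (Fo P) (\<lambda>i. Fa (\<pi> i)))"

text \<open>\<open>F : C \<rightarrow> D\<close> is left adjoint to \<open>G : D \<rightarrow> C\<close>, by a bijection
  \<open>D(F X, Y) \<cong> C(X, G Y)\<close> natural in \<open>X\<close> and \<open>Y\<close>.\<close>

definition is_left_adjoint ::
  "('o, 'm) category_data \<Rightarrow> ('p, 'n) category_data \<Rightarrow>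
   ('o \<Rightarrow> 'p) \<Rightarrow> ('m \<Rightarrow> 'n) \<Rightarrow> ('p \<Rightarrow> 'o) \<Rightarrow> ('n \<Rightarrow> 'm) \<Rightarrow> bool" where
  "is_left_adjoint C D Fo Fa Go Ga \<longleftrightarrow>
     is_functor C D Fo Fa \<and> is_functor D C Go Ga \<and>
     (\<exists>\<phi>. (\<forall>X \<in> Obj C. \<forall>Y \<in> Obj D. bij_betw (\<phi> X Y) (hom D (Fo X) Y) (hom C X (Go Y))) \<and>
        (\<forall>X X' Y Y'. \<forall>a \<in> hom C X' X. \<forall>b \<in> hom D Y Y'. \<forall>f \<in> hom D (Fo X) Y.
           \<phi> X' Y' (b \<cdot>\<^bsub>D\<^esub> f \<cdot>\<^bsub>D\<^esub> Fa a) = Ga b \<cdot>\<^bsub>C\<^esub> \<phi> X Y f \<cdot>\<^bsub>C\<^esub> a))"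

end

theory Submission
  imports Defs
begin

text \<open>An arrow \<open>f : X \<rightarrow> D\<close> with \<open>D\<close> decidable factors through the decidable quotient
  \<open>p : X \<rightarrow> \<Pi> X\<close>: the image of \<open>(p, f) : X \<rightarrow> \<Pi> X \<times> D\<close> is a decidable object lying between \<open>X\<close>
  and \<open>\<Pi> X\<close>, hence another decidable quotient of \<open>X\<close>, and uniqueness of decidable quotients makes it
  isomorphic to \<open>\<Pi> X\<close> under \<open>X\<close>. This gives the reflection, using only (DQO).

  For products it suffices that \<open>p \<times> p : X \<times> Y \<rightarrow> \<Pi> X \<times> \<Pi> Y\<close> is a decidable quotient. It is epi, so an
  arrow \<open>f : X \<times> Y \<rightarrow> 2\<close> factors through it as soon as \<open>f\<close> identifies all pairs of generalized
  elements that \<open>p \<times> p\<close> identifies. Since 2 is decidable, equality of two arrows into 2 is a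
  complemented condition on their domain, so by (NS) it can be tested on points; and for points
  \<open>(x, y)\<close>, \<open>(x', y')\<close> one passes through \<open>(x', y)\<close>, as \<open>f (-, y)\<close> and \<open>f (x', -)\<close> factor through \<open>p\<close>.\<close>

section \<open>Subobjects as sieves of generalized elements\<close>

text \<open>Pullbacks, exponentials and a classifier are the only structure given, so falsity,
  universal quantifiers and images are made from equalizers and power objects by second-order
  formulas. A union is handled through its upper bounds: \<open>M\<close> and its negation cover
  \<open>W\<close> when every subobject containing both is total. Stability of such a cover under
  pullback then rests on the universal quantifier, which carries upper bounds along arrows.

  (DQO) tests quotients against 2 only. Its uniqueness clause is what reaches an arbitrary decidable
  object: the epi part \<open>e\<close> of \<open>(p, f)\<close> is a factor of \<open>p\<close>, so
  whatever factors through \<open>p\<close> factors through \<open>e\<close>, and \<open>e\<close>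
  passes the same test. In the product step, agreement on identified pairs is enough to factor an
  arrow because in a topos every epi is the quotient of its kernel pair.\<close>

context category
begin

section \<open>Calculus of composites, products and monos\<close>

declare Dom_in_Obj [simp] Cod_in_Obj [simp]

lemma hom_iff: "f \<in> hom C X Y \<longleftrightarrow> f \<in> Arr C \<and> Dom C f = X \<and> Cod C f = Y"
  by (simp add: hom_def)

lemma Comp_Arr [simp]:
  assumes "f \<in> Arr C" "g \<in> Arr C" "Cod C f = Dom C g"
  shows "g \<cdot> f \<in> Arr C" "Dom C (g \<cdot> f) = Dom C f" "Cod C (g \<cdot> f) = Cod C g"
  using Comp_in_hom[of f "Dom C f" "Cod C f" g "Cod C g"] assms by (auto simp: hom_iff)

lemma Id_Arr [simp]:
  assumes "X \<in> Obj C"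
  shows "Id C X \<in> Arr C" "Dom C (Id C X) = X" "Cod C (Id C X) = X"
  using Id_in_hom[OF assms] by (auto simp: hom_iff)

lemma Comp_Id_right [simp]: "f \<in> Arr C \<Longrightarrow> Dom C f = X \<Longrightarrow> f \<cdot> Id C X = f"
  using Comp_Id[of f X "Cod C f"] by (simp add: hom_iff)

lemma Comp_Id_left [simp]: "f \<in> Arr C \<Longrightarrow> Cod C f = X \<Longrightarrow> Id C X \<cdot> f = f"
  using Id_Comp[of f "Dom C f" X] by (simp add: hom_iff)

lemma assoc [simp]:
  assumes "f \<in> Arr C" "g \<in> Arr C" "h \<in> Arr C" "Cod C f = Dom C g" "Cod C g = Dom C h"
  shows "(h \<cdot> g) \<cdot> f = h \<cdot> (g \<cdot> f)"
  using assms Comp_assoc[of f "Dom C f" "Cod C f" g "Cod C g" h "Cod C h"] by (simp add: hom_iff)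

text \<open>The simplifier nests composites to the right, so an equation for
  \<open>g \<cdot> f\<close> no longer matches inside \<open>g \<cdot> (f \<cdot> a)\<close>. This
  and \<open>Comp_square\<close> supply the nested instance.\<close>

lemma Comp_Comp_eq:
  assumes "g \<cdot> f = k" "a \<in> Arr C" "f \<in> Arr C" "g \<in> Arr C" "Cod C a = Dom C f" "Cod C f = Dom C g"
  shows "g \<cdot> (f \<cdot> a) = k \<cdot> a"
  using assms by (metis assoc)

lemma Comp_square:
  assumes "g \<cdot> f = k \<cdot> h" "a \<in> Arr C" "f \<in> Arr C" "g \<in> Arr C" "h \<in> Arr C" "k \<in> Arr C"
    "Cod C a = Dom C f" "Cod C f = Dom C g" "Cod C a = Dom C h" "Cod C h = Dom C k"
  shows "g \<cdot> (f \<cdot> a) = k \<cdot> (h \<cdot> a)"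
  using assms by (metis assoc)

lemma hom_objs: "f \<in> hom C X Y \<Longrightarrow> X \<in> Obj C \<and> Y \<in> Obj C"
  using Dom_in_Obj Cod_in_Obj by (auto simp: hom_iff)

lemma product_pair:
  assumes "is_binary_product C X Y P p q" "f \<in> hom C W X" "g \<in> hom C W Y"
  obtains h where "h \<in> hom C W P" "p \<cdot> h = f" "q \<cdot> h = g"
  using assms unfolding is_binary_product_def by blast

lemma product_ext:
  assumes "is_binary_product C X Y P p q" "h \<in> hom C W P" "k \<in> hom C W P"
    and "p \<cdot> h = p \<cdot> k" "q \<cdot> h = q \<cdot> k"
  shows "h = k"
proof -
  have "p \<cdot> k \<in> hom C W X" "q \<cdot> k \<in> hom C W Y"
    using assms Comp_in_hom unfolding is_binary_product_def by blast+
  then show ?thesis using assms unfolding is_binary_product_def by metis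
qed

lemma productD:
  assumes "is_binary_product C X Y P p q"
  shows "p \<in> Arr C" "q \<in> Arr C" "Dom C p = P" "Dom C q = P" "Cod C p = X" "Cod C q = Y"
    "X \<in> Obj C" "Y \<in> Obj C" "P \<in> Obj C"
  using assms hom_objs unfolding is_binary_product_def by (auto simp: hom_iff)

lemma finite_product_ex1:
  assumes "is_finite_product C n X P \<pi>" "W \<in> Obj C" "\<And>i. i < n \<Longrightarrow> f i \<in> hom C W (X i)"
  shows "\<exists>!h. h \<in> hom C W P \<and> (\<forall>i<n. \<pi> i \<cdot> h = f i)"
  using assms unfolding is_finite_product_def by simp

lemma monoD:
  assumes "is_mono C m" "m \<cdot> f = m \<cdot> g" "f \<in> hom C W (Dom C m)" "g \<in> hom C W (Dom C m)"
  shows "f = g"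
  using assms unfolding is_mono_def by blast

section \<open>Generalized elements and the forcing clauses\<close>

definition into :: "'o \<Rightarrow> 'm set" where
  "into W = {t \<in> Arr C. Cod C t = W}"

text \<open>The sieve is the same for all monos representing one subobject, so equality and
  inclusion of subobjects become equality and inclusion of sets.\<close>

definition below :: "'m \<Rightarrow> 'm set" where
  "below m = {m \<cdot> h |h. h \<in> into (Dom C m)}"

text \<open>A subobject of \<open>W\<close> is handled through the sieve of those generalized elements of \<open>W\<close>
  that belong to it, so that proofs follow Kripke--Joyal semantics.\<close>

definition rep :: "'o \<Rightarrow> 'm set \<Rightarrow> bool" where
  "rep W R \<longleftrightarrow> (\<exists>m \<in> monos_into C W. R = below m)"

definition Eq :: "'m \<Rightarrow> 'm \<Rightarrow> 'm set" where
  "Eq f g = {t \<in> into (Dom C f). f \<cdot> t = g \<cdot> t}"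

definition inverse_image :: "'m \<Rightarrow> 'm set \<Rightarrow> 'm set" where
  "inverse_image f R = {t \<in> into (Dom C f). f \<cdot> t \<in> R}"

text \<open>Kripke--Joyal clause for the right adjoint of inverse image along \<open>f\<close>: at
  every later stage \<open>a\<close>, the whole fibre of \<open>f\<close> over \<open>t\<close> lies
  in \<open>U\<close>.\<close>

definition Forall :: "'m \<Rightarrow> 'm set \<Rightarrow> 'm set" where
  "Forall f U = {t \<in> into (Cod C f). \<forall>a \<in> into (Dom C t). \<forall>y \<in> into (Dom C f).
     Dom C y = Dom C a \<longrightarrow> f \<cdot> y = t \<cdot> a \<longrightarrow> y \<in> U}"

text \<open>The implication is tested after every change of stage \<open>a\<close>, which makes the
  set of such \<open>t\<close> closed under restriction.\<close>

definition Imp :: "'o \<Rightarrow> 'm set \<Rightarrow> 'm set \<Rightarrow> 'm set" where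
  "Imp W R S = {t \<in> into W. \<forall>a \<in> into (Dom C t). t \<cdot> a \<in> R \<longrightarrow> t \<cdot> a \<in> S}"

lemma into_iff: "t \<in> into W \<longleftrightarrow> t \<in> Arr C \<and> Cod C t = W"
  by (simp add: into_def)

lemma ForallD:
  assumes "t \<in> Forall f U" "a \<in> into (Dom C t)" "y \<in> into (Dom C f)" "Dom C y = Dom C a"
    "f \<cdot> y = t \<cdot> a"
  shows "y \<in> U"
  using assms unfolding Forall_def by blast

lemma ImpD:
  assumes "t \<in> Imp W R S" "a \<in> into (Dom C t)" "t \<cdot> a \<in> R"
  shows "t \<cdot> a \<in> S"
  using assms unfolding Imp_def by blast

lemma monos_into_iff: "m \<in> monos_into C W \<longleftrightarrow> is_mono C m \<and> Cod C m = W"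
  by (simp add: monos_into_def)

lemma mono_Arr: "is_mono C m \<Longrightarrow> m \<in> Arr C"
  by (simp add: is_mono_def)

lemma repE:
  assumes "rep W R"
  obtains m where "is_mono C m" "m \<in> Arr C" "Cod C m = W" "R = below m"
  using assms mono_Arr unfolding rep_def by (auto simp: monos_into_iff)

lemma rep_below: "is_mono C m \<Longrightarrow> Cod C m = W \<Longrightarrow> rep W (below m)"
  by (auto simp: rep_def monos_into_iff)

lemma below_self: "m \<in> Arr C \<Longrightarrow> m \<in> below m"
  unfolding below_def using Dom_in_Obj
  by (auto simp: into_iff intro!: exI[of _ "Id C (Dom C m)"])

lemma sub_le_iff:
  assumes "m \<in> Arr C" "n \<in> Arr C" "Cod C m = Cod C n"
  shows "sub_le C m n \<longleftrightarrow> m \<in> below n"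
  using assms unfolding sub_le_def below_def by (fastforce simp: into_iff hom_iff)

lemma rep_closed: "rep W R \<Longrightarrow> t \<in> R \<Longrightarrow> a \<in> into (Dom C t) \<Longrightarrow> t \<cdot> a \<in> R"
  by (erule repE) (force simp: below_def into_iff)

lemma rep_into: "rep W R \<Longrightarrow> t \<in> R \<Longrightarrow> t \<in> into W"
  by (erule repE) (force simp: below_def into_iff)

lemma rep_Obj: "rep W R \<Longrightarrow> W \<in> Obj C"
  by (erule repE) (use Cod_in_Obj in blast)

lemma rep_total: "rep W R \<Longrightarrow> Id C W \<in> R \<Longrightarrow> t \<in> into W \<Longrightarrow> t \<in> R"
  using rep_closed[of W R "Id C W" t] rep_Obj[of W R] by (simp add: into_iff)

lemma mono_Id: "W \<in> Obj C \<Longrightarrow> is_mono C (Id C W)"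
  unfolding is_mono_def by (auto simp: hom_iff)

lemma rep_into_self: "W \<in> Obj C \<Longrightarrow> rep W (into W)"
  using rep_below[of "Id C W" W] mono_Id[of W]
  by (force simp: below_def into_def elim!: back_subst[of "rep W"])

lemma mono_Comp:
  assumes "is_mono C m" "is_mono C n" "Cod C m = Dom C n"
  shows "is_mono C (n \<cdot> m)"
  unfolding is_mono_def
proof (intro conjI allI ballI impI)
  note A = mono_Arr[OF assms(1)] mono_Arr[OF assms(2)]
  show "n \<cdot> m \<in> Arr C" using A assms by simp
  fix W f g assume fg: "f \<in> hom C W (Dom C (n \<cdot> m))" "g \<in> hom C W (Dom C (n \<cdot> m))"
    and e: "n \<cdot> m \<cdot> f = n \<cdot> m \<cdot> g"
  have "m \<cdot> f = m \<cdot> g"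
    by (rule monoD[OF assms(2), of _ _ W]) (use A assms fg e in \<open>auto simp: hom_iff\<close>)
  then show "f = g"
    by (rule monoD[OF assms(1), of _ _ W]) (use A assms fg e in \<open>auto simp: hom_iff\<close>)
qed

lemma pullback_lift:
  assumes "is_pullback C f g P p q" "a \<in> hom C W (Dom C f)" "b \<in> hom C W (Dom C g)"
    and "f \<cdot> a = g \<cdot> b"
  obtains h where "h \<in> hom C W P" "p \<cdot> h = a" "q \<cdot> h = b"
  using assms unfolding is_pullback_def by blast

lemma mono_pullback:
  assumes pb: "is_pullback C f m P p q" and m: "is_mono C m"
  shows "is_mono C p"
proof -
  have D: "f \<in> Arr C" "m \<in> Arr C" "Cod C f = Cod C m" "p \<in> hom C P (Dom C f)" "q \<in> hom C P (Dom C m)"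
    "f \<cdot> p = m \<cdot> q"
    using pb unfolding is_pullback_def by auto
  show ?thesis unfolding is_mono_def
  proof (intro conjI allI ballI impI)
    show "p \<in> Arr C" using D by (simp add: hom_iff)
    fix W a b assume ab: "a \<in> hom C W (Dom C p)" "b \<in> hom C W (Dom C p)" "p \<cdot> a = p \<cdot> b"
    have e: "m \<cdot> (q \<cdot> a) = f \<cdot> (p \<cdot> a)" "m \<cdot> (q \<cdot> b) = f \<cdot> (p \<cdot> b)"
      using Comp_square[OF D(6), of a] Comp_square[OF D(6), of b] D(1-5) ab by (simp_all add: hom_iff)
    then have "m \<cdot> (q \<cdot> a) = m \<cdot> (q \<cdot> b)" using ab by simp
    then have "q \<cdot> a = q \<cdot> b"
      by (rule monoD[OF m, of _ _ W]) (use D ab in \<open>auto simp: hom_iff\<close>)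
    moreover have "p \<cdot> a \<in> hom C W (Dom C f)" "q \<cdot> a \<in> hom C W (Dom C m)" "f \<cdot> (p \<cdot> a) = m \<cdot> (q \<cdot> a)"
      using D ab e by (auto simp: hom_iff)
    then have "\<exists>!h. h \<in> hom C W P \<and> p \<cdot> h = p \<cdot> a \<and> q \<cdot> h = q \<cdot> a"
      using pb unfolding is_pullback_def by blast
    ultimately show "a = b" using ab D by (auto simp: hom_iff)
  qed
qed

lemma below_pullback:
  assumes pb: "is_pullback C f m P p q"
  shows "below p = inverse_image f (below m)"
proof -
  have D: "f \<in> Arr C" "m \<in> Arr C" "Cod C f = Cod C m" "p \<in> hom C P (Dom C f)" "q \<in> hom C P (Dom C m)"
    "f \<cdot> p = m \<cdot> q"
    using pb unfolding is_pullback_def by auto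
  show ?thesis
  proof (intro set_eqI iffI)
    fix t assume "t \<in> below p"
    then obtain h where h: "h \<in> into P" "t = p \<cdot> h"
      using D by (auto simp: below_def hom_iff)
    have "f \<cdot> (p \<cdot> h) = m \<cdot> (q \<cdot> h)"
      using Comp_square[OF D(6), of h] D(1-5) h by (simp add: hom_iff into_iff)
    then show "t \<in> inverse_image f (below m)"
      using h D by (auto simp: inverse_image_def below_def into_iff hom_iff intro!: exI[of _ "q \<cdot> h"])
  next
    fix t assume "t \<in> inverse_image f (below m)"
    then obtain h where h: "h \<in> into (Dom C m)" "f \<cdot> t = m \<cdot> h" "t \<in> into (Dom C f)"
      by (auto simp: inverse_image_def below_def)
    have "Dom C h = Dom C t"
      using h D(1-5) Comp_Arr(2)[of t f] Comp_Arr(2)[of h m] by (simp add: into_iff)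
    then obtain k where "k \<in> hom C (Dom C t) P" "p \<cdot> k = t"
      using pullback_lift[OF pb, of t "Dom C t" h] h by (auto simp: into_iff hom_iff)
    then show "t \<in> below p"
      using D by (auto simp: below_def into_iff hom_iff)
  qed
qed

end

section \<open>The internal logic of a topos\<close>

locale topos = category C
  for C :: "('o, 'm) category_data" (structure) +
  fixes T \<Omega> :: 'o and tr :: 'm
  assumes finite_limits: "has_finite_limits C"
    and exponentials: "has_exponentials C"
    and classifier: "is_subobject_classifier C T \<Omega> tr"
begin

section \<open>Terminal object, products and equalizers\<close>

definition bang :: "'o \<Rightarrow> 'm" where
  "bang A = (THE f. f \<in> hom C A T)"

text \<open>The truth value \<open>true\<close> at stage \<open>A\<close>. An equation
  \<open>R = Eq \<chi> (tt W)\<close> says that \<open>\<chi>\<close> classifies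
  \<open>R\<close>.\<close>

definition tt :: "'o \<Rightarrow> 'm" where
  "tt A = tr \<cdot> bang A"

lemma terminal_T: "is_terminal C T"
  using classifier by (simp add: is_subobject_classifier_def)

lemma T_Obj [simp]: "T \<in> Obj C"
  using terminal_T by (simp add: is_terminal_def)

lemma bang_in_hom: "A \<in> Obj C \<Longrightarrow> bang A \<in> hom C A T"
  unfolding bang_def using terminal_T theI'[of "\<lambda>f. f \<in> hom C A T"] by (simp add: is_terminal_def)

lemma bang_Arr [simp]:
  assumes "A \<in> Obj C"
  shows "bang A \<in> Arr C" "Dom C (bang A) = A" "Cod C (bang A) = T"
  using bang_in_hom[OF assms] by (auto simp: hom_iff)

lemma to_T_eq: "f \<in> hom C A T \<Longrightarrow> g \<in> hom C A T \<Longrightarrow> f = g"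
  using terminal_T hom_objs[of f A T] by (auto simp: is_terminal_def)

lemma bang_Comp: "a \<in> Arr C \<Longrightarrow> Cod C a = A \<Longrightarrow> bang A \<cdot> a = bang (Dom C a)"
  using Dom_in_Obj Cod_in_Obj by (intro to_T_eq[of _ "Dom C a"]) (auto simp: hom_iff)

lemma tr_Arr [simp]: "tr \<in> Arr C" "Dom C tr = T" "Cod C tr = \<Omega>"
  using classifier by (auto simp: is_subobject_classifier_def hom_iff)

lemma Omega_Obj [simp]: "\<Omega> \<in> Obj C"
  using Cod_in_Obj[of tr] by simp

lemma tt_Arr [simp]:
  assumes "A \<in> Obj C"
  shows "tt A \<in> Arr C" "Dom C (tt A) = A" "Cod C (tt A) = \<Omega>"
  using assms by (auto simp: tt_def)

lemma tt_Comp: "a \<in> Arr C \<Longrightarrow> Cod C a = A \<Longrightarrow> tt A \<cdot> a = tt (Dom C a)"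
  using Cod_in_Obj[of a] by (auto simp: tt_def bang_Comp)

lemma pullback_exists:
  assumes "f \<in> Arr C" "g \<in> Arr C" "Cod C f = Cod C g"
  obtains P p q where "is_pullback C f g P p q"
  using finite_limits assms unfolding has_finite_limits_def by blast

lemma product_exists:
  assumes "X \<in> Obj C" "Y \<in> Obj C"
  obtains P p q where "is_binary_product C X Y P p q"
proof -
  obtain P p q where pb: "is_pullback C (bang X) (bang Y) P p q"
    by (rule pullback_exists[of "bang X" "bang Y"]) (use assms in auto)
  have "is_binary_product C X Y P p q"
    unfolding is_binary_product_def
  proof (intro conjI allI ballI)
    show "p \<in> hom C P X" "q \<in> hom C P Y"
      using pb assms by (auto simp: is_pullback_def)
    fix W f g assume fg: "f \<in> hom C W X" "g \<in> hom C W Y"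
    then have "bang X \<cdot> f = bang Y \<cdot> g"
      using assms by (auto simp: hom_iff bang_Comp)
    then show "\<exists>!h. h \<in> hom C W P \<and> p \<cdot> h = f \<and> q \<cdot> h = g"
      using pb assms fg by (simp add: is_pullback_def)
  qed
  then show ?thesis using that by blast
qed

lemma rep_inverse_image:
  assumes "rep W R" "f \<in> Arr C" "Cod C f = W"
  shows "rep (Dom C f) (inverse_image f R)"
proof -
  obtain m where m: "is_mono C m" "m \<in> Arr C" "Cod C m = W" "R = below m"
    using repE[OF assms(1)] by blast
  obtain P p q where pb: "is_pullback C f m P p q"
    by (rule pullback_exists[of f m]) (use assms m in auto)
  then have "Cod C p = Dom C f" by (simp add: is_pullback_def hom_iff)
  then have "rep (Dom C f) (below p)"
    using mono_pullback[OF pb m(1)] by (intro rep_below)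
  then show ?thesis using below_pullback[OF pb] m(4) by simp
qed

lemma below_Comp:
  assumes "is_mono C m" "n \<in> Arr C" "Cod C n = Dom C m"
  shows "below (m \<cdot> n) = {m \<cdot> t |t. t \<in> below n}"
  using assms mono_Arr[OF assms(1)] by (force simp: below_def into_iff)

lemma Comp_in_below_iff:
  assumes "is_mono C m" "n \<in> Arr C" "Cod C n = Dom C m" "t \<in> into (Dom C m)"
  shows "m \<cdot> t \<in> below (m \<cdot> n) \<longleftrightarrow> t \<in> below n"
proof
  note m = mono_Arr[OF assms(1)]
  assume "m \<cdot> t \<in> below (m \<cdot> n)"
  then obtain s where s: "s \<in> below n" "m \<cdot> t = m \<cdot> s"
    using below_Comp[OF assms(1-3)] by auto
  have S: "s \<in> Arr C" "Cod C s = Dom C m"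
    using s assms by (auto simp: below_def into_iff)
  have "Dom C t = Dom C s"
    using s(2) S m assms Comp_Arr(2)[of t m] Comp_Arr(2)[of s m] by (simp add: into_iff)
  then have "t = s"
    using monoD[OF assms(1) s(2), of "Dom C t"] S assms by (simp add: hom_iff into_iff)
  then show "t \<in> below n" using s by simp
qed (use below_Comp[OF assms(1-3)] in auto)

text \<open>The meet is the composite of the mono for \<open>R\<close> with the pullback of
  \<open>S\<close> along it.\<close>

lemma rep_Int:
  assumes "rep W R" "rep W S"
  shows "rep W (R \<inter> S)"
proof -
  obtain m where m: "is_mono C m" "m \<in> Arr C" "Cod C m = W" "R = below m"
    using repE[OF assms(1)] by blast
  obtain n where n: "is_mono C n" "n \<in> Arr C" "Cod C n = Dom C m" "inverse_image m S = below n"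
    using repE[OF rep_inverse_image[OF assms(2) m(2,3)]] by blast
  have "R \<inter> S = below (m \<cdot> n)"
    unfolding below_Comp[OF m(1) n(2,3)] n(4)[symmetric] m(4)
    by (auto simp: below_def inverse_image_def)
  then show ?thesis
    using rep_below[OF mono_Comp[OF n(1) m(1) n(3)], of W] m n by simp
qed

lemma split_mono:
  assumes "p \<in> Arr C" "d \<in> Arr C" "Cod C d = Dom C p" "p \<cdot> d = Id C (Dom C d)"
  shows "is_mono C d"
  unfolding is_mono_def
proof (intro conjI allI ballI impI)
  show "d \<in> Arr C" by (rule assms)
  fix W f g assume fg: "f \<in> hom C W (Dom C d)" "g \<in> hom C W (Dom C d)" "d \<cdot> f = d \<cdot> g"
  have "p \<cdot> (d \<cdot> f) = f" "p \<cdot> (d \<cdot> g) = g"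
    using fg(1,2) assms(1-3) Comp_Comp_eq[OF assms(4), of f] Comp_Comp_eq[OF assms(4), of g]
    by (simp_all add: hom_iff)
  then show "f = g" using fg(3) by metis
qed

text \<open>The diagonal consists of the pairs with equal coordinates. The complement demanded by
  \<open>decidable\<close> thus concerns \<open>Eq p q\<close>, from which every
  \<open>Eq f g\<close> arises by pullback along \<open>(f, g)\<close>.\<close>

lemma below_diagonal:
  assumes P: "is_binary_product C X X P p q"
    and d: "d \<in> hom C X P" "p \<cdot> d = Id C X" "q \<cdot> d = Id C X"
  shows "below d = Eq p q"
proof (intro set_eqI iffI)
  note D = productD[OF P]
  fix t assume "t \<in> below d"
  then obtain h where h: "h \<in> into X" "t = d \<cdot> h"
    using d by (auto simp: below_def hom_iff)
  then have "p \<cdot> (d \<cdot> h) = h" "q \<cdot> (d \<cdot> h) = h"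
    using Comp_Comp_eq[OF d(2), of h] Comp_Comp_eq[OF d(3), of h] d(1) D
    by (simp_all add: hom_iff into_iff)
  then show "t \<in> Eq p q" using h d(1) D by (auto simp: Eq_def into_iff hom_iff)
next
  note D = productD[OF P]
  fix t assume t: "t \<in> Eq p q"
  have "p \<cdot> (d \<cdot> (p \<cdot> t)) = p \<cdot> t" "q \<cdot> (d \<cdot> (p \<cdot> t)) = p \<cdot> t"
    using Comp_Comp_eq[OF d(2), of "p \<cdot> t"] Comp_Comp_eq[OF d(3), of "p \<cdot> t"] d(1) D t
    by (auto simp add: hom_iff into_iff Eq_def)
  then have "t = d \<cdot> (p \<cdot> t)"
    using d(1) D t by (intro product_ext[OF P, of t "Dom C t" "d \<cdot> (p \<cdot> t)"]) (auto simp: Eq_def hom_iff into_iff)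
  moreover have "p \<cdot> t \<in> into (Dom C d)"
    using d(1) D t by (auto simp: Eq_def hom_iff into_iff)
  ultimately show "t \<in> below d" unfolding below_def by blast
qed

lemma inverse_image_diagonal:
  assumes P: "is_binary_product C X X P p q"
    and h: "h \<in> hom C W P" "p \<cdot> h = f" "q \<cdot> h = g"
  shows "inverse_image h (Eq p q) = Eq f g"
proof -
  note D = productD[OF P]
  have "p \<cdot> (h \<cdot> t) = f \<cdot> t" "q \<cdot> (h \<cdot> t) = g \<cdot> t" if "t \<in> into W" for t
    using Comp_Comp_eq[OF h(2), of t] Comp_Comp_eq[OF h(3), of t] D h(1) that
    by (simp_all add: hom_iff into_iff)
  moreover have "Dom C f = W" using h D by (auto simp: hom_iff)
  ultimately show ?thesis
    using h(1) D by (auto simp: inverse_image_def Eq_def into_iff hom_iff)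
qed

lemma rep_Eq:
  assumes "f \<in> hom C W D" "g \<in> hom C W D"
  shows "rep W (Eq f g)"
proof -
  have O: "W \<in> Obj C" "D \<in> Obj C" using hom_objs[OF assms(1)] by auto
  obtain P p q where P: "is_binary_product C D D P p q"
    using product_exists[OF O(2) O(2)] by blast
  note D = productD[OF P]
  obtain d where d: "d \<in> hom C D P" "p \<cdot> d = Id C D" "q \<cdot> d = Id C D"
    using product_pair[OF P Id_in_hom[OF O(2)] Id_in_hom[OF O(2)]] by blast
  obtain h where h: "h \<in> hom C W P" "p \<cdot> h = f" "q \<cdot> h = g"
    using product_pair[OF P assms] by blast
  have "is_mono C d"
    using d D by (intro split_mono[of p]) (auto simp: hom_iff)
  then have "rep P (Eq p q)"
    using d rep_below[of d P] below_diagonal[OF P d] by (simp add: hom_iff)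
  from rep_inverse_image[OF this, of h] have "rep W (inverse_image h (Eq p q))"
    using h by (simp add: hom_iff)
  then show ?thesis using inverse_image_diagonal[OF P h] by simp
qed

section \<open>Subobjects and their classifying arrows\<close>

lemma below_tr: "below tr = {\<omega>. \<omega> \<in> into \<Omega> \<and> \<omega> = tt (Dom C \<omega>)}"
proof (intro set_eqI iffI)
  fix \<omega> assume "\<omega> \<in> below tr"
  then obtain h where h: "h \<in> Arr C" "Cod C h = T" "\<omega> = tr \<cdot> h"
    by (auto simp: below_def into_iff)
  then have "h = bang (Dom C h)"
    using Dom_in_Obj[of h] by (intro to_T_eq[of _ "Dom C h"]) (auto simp: hom_iff)
  then show "\<omega> \<in> {\<omega>. \<omega> \<in> into \<Omega> \<and> \<omega> = tt (Dom C \<omega>)}"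
    using h by (auto simp: tt_def into_iff)
next
  fix \<omega> assume "\<omega> \<in> {\<omega>. \<omega> \<in> into \<Omega> \<and> \<omega> = tt (Dom C \<omega>)}"
  then show "\<omega> \<in> below tr"
    using Dom_in_Obj[of \<omega>] unfolding tt_def below_def by (force simp: into_iff)
qed

lemma inverse_image_tr:
  assumes "\<chi> \<in> hom C W \<Omega>"
  shows "inverse_image \<chi> (below tr) = Eq \<chi> (tt W)"
  using assms unfolding below_tr inverse_image_def Eq_def
  by (auto simp: hom_iff into_iff tt_Comp)

text \<open>Every subobject is the equalizer of its classifying arrow and \<open>true\<close>, so
  membership becomes an equation between arrows.\<close>

lemma classify:
  assumes "rep W R"
  obtains \<chi> where "\<chi> \<in> hom C W \<Omega>" "R = Eq \<chi> (tt W)"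
proof -
  obtain m where m: "is_mono C m" "m \<in> Arr C" "Cod C m = W" "R = below m"
    using repE[OF assms(1)] by blast
  obtain \<chi> u where "\<chi> \<in> hom C W \<Omega>" "is_pullback C \<chi> tr (Dom C m) m u"
    using classifier m unfolding is_subobject_classifier_def by blast
  then show ?thesis using that[of \<chi>] below_pullback inverse_image_tr m by metis
qed

lemma classify_pullback:
  assumes \<chi>: "\<chi> \<in> hom C W \<Omega>" and m: "is_mono C m" "Cod C m = W" "below m = Eq \<chi> (tt W)"
  shows "is_pullback C \<chi> tr (Dom C m) m (bang (Dom C m))"
proof -
  note A = mono_Arr[OF m(1)]
  have W: "W \<in> Obj C" "Dom C m \<in> Obj C" using hom_objs[OF \<chi>] Dom_in_Obj A by auto
  show ?thesis unfolding is_pullback_def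
  proof (intro conjI allI ballI impI)
    have "m \<in> Eq \<chi> (tt W)" using below_self[OF A] m(3) by simp
    then show "\<chi> \<cdot> m = tr \<cdot> bang (Dom C m)"
      using A m(2) tt_Comp[of m W] by (simp add: Eq_def tt_def)
    fix V a b assume ab: "a \<in> hom C V (Dom C \<chi>)" "b \<in> hom C V (Dom C tr)" "\<chi> \<cdot> a = tr \<cdot> b"
    have V: "V \<in> Obj C" using hom_objs ab by blast
    have b: "b = bang V" using ab bang_in_hom[OF V] to_T_eq by simp
    have "a \<in> Eq \<chi> (tt W)" using ab \<chi> b tt_Comp[of a W] by (simp add: Eq_def hom_iff into_iff tt_def)
    then obtain h where h: "h \<in> into (Dom C m)" "a = m \<cdot> h"
      using m by (auto simp: below_def)
    have hV: "h \<in> hom C V (Dom C m)"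
      using h A ab by (auto simp: into_iff hom_iff)
    show "\<exists>!h. h \<in> hom C V (Dom C m) \<and> m \<cdot> h = a \<and> bang (Dom C m) \<cdot> h = b"
    proof (intro ex1I conjI)
      show "bang (Dom C m) \<cdot> h = b" using hV b by (simp add: hom_iff bang_Comp)
      show "k = h" if "k \<in> hom C V (Dom C m) \<and> m \<cdot> k = a \<and> bang (Dom C m) \<cdot> k = b" for k
        using monoD[OF m(1), of k h V] that h hV by auto
    qed (use h hV in auto)
  qed (use A \<chi> m W in \<open>auto simp: hom_iff\<close>)
qed

text \<open>Extensionality of truth values: both arrows classify the same mono, by
  \<open>classify_pullback\<close>.\<close>

lemma classify_unique:
  assumes "\<chi> \<in> hom C W \<Omega>" "\<chi>' \<in> hom C W \<Omega>" "Eq \<chi> (tt W) = Eq \<chi>' (tt W)"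
  shows "\<chi> = \<chi>'"
proof -
  have W: "W \<in> Obj C" using hom_objs assms by blast
  have "rep W (Eq \<chi> (tt W))" using assms W by (intro rep_Eq[of _ _ \<Omega>]) (auto simp: hom_iff)
  then obtain m where m: "is_mono C m" "m \<in> Arr C" "Cod C m = W" "below m = Eq \<chi> (tt W)"
    by (metis repE)
  have "\<exists>u. is_pullback C \<chi> tr (Dom C m) m u" "\<exists>u. is_pullback C \<chi>' tr (Dom C m) m u"
    using classify_pullback assms m by metis+
  moreover have "\<exists>!\<chi>. \<chi> \<in> hom C (Cod C m) \<Omega> \<and> (\<exists>u. is_pullback C \<chi> tr (Dom C m) m u)"
    using classifier m(1) unfolding is_subobject_classifier_def by simp
  ultimately show ?thesis using assms m(3) by auto
qed


section \<open>Power objects and quantification\<close>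

lemma exponential_exists:
  assumes "X \<in> Obj C" "Y \<in> Obj C"
  obtains E P p q ev where "is_exponential C X Y E P p q ev"
  using exponentials assms unfolding has_exponentials_def by blast

lemma curry:
  assumes "is_exponential C X Y E P p q ev" "is_binary_product C W X Q r s" "f \<in> hom C Q Y"
  obtains g t where "g \<in> hom C W E" "t \<in> hom C Q P" "p \<cdot> t = g \<cdot> r" "q \<cdot> t = s" "ev \<cdot> t = f"
  using assms unfolding is_exponential_def by blast

lemma curry_unique:
  assumes E: "is_exponential C X Y E P p q ev" and Q: "is_binary_product C W X Q r s"
    and g: "g \<in> hom C W E" "t \<in> hom C Q P" "p \<cdot> t = g \<cdot> r" "q \<cdot> t = s"
    and g': "g' \<in> hom C W E" "t' \<in> hom C Q P" "p \<cdot> t' = g' \<cdot> r" "q \<cdot> t' = s"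
    and "ev \<cdot> t = ev \<cdot> t'"
  shows "g = g'"
proof -
  have "ev \<in> hom C P Y" using E by (simp add: is_exponential_def)
  then have "ev \<cdot> t \<in> hom C Q Y" using g by (simp add: hom_iff)
  then have "\<exists>!g. g \<in> hom C W E \<and>
      (\<exists>u \<in> hom C Q P. p \<cdot> u = g \<cdot> r \<and> q \<cdot> u = s \<and> ev \<cdot> u = ev \<cdot> t)"
    using E Q unfolding is_exponential_def by simp
  moreover have "\<exists>u \<in> hom C Q P. p \<cdot> u = g \<cdot> r \<and> q \<cdot> u = s \<and> ev \<cdot> u = ev \<cdot> t"
    "\<exists>u \<in> hom C Q P. p \<cdot> u = g' \<cdot> r \<and> q \<cdot> u = s \<and> ev \<cdot> u = ev \<cdot> t"
    using assms by (auto intro: bexI[of _ t] bexI[of _ t'])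
  ultimately show ?thesis using g(1) g'(1) by auto
qed

text \<open>Elements of \<open>E\<close> are equal when they take equal values on all of
  \<open>Y\<close>; here \<open>k\<close> is \<open>t \<times> Y\<close>. For
  \<open>Z = \<Omega>\<close> this is extensionality of subsets of \<open>Y\<close>.\<close>

lemma transpose_eq_iff:
  assumes E: "is_exponential C Y Z E Q pe qe ev" and P: "is_binary_product C X Y P p q"
    and a: "a \<in> hom C X E" "\<alpha> \<in> hom C P Q" "pe \<cdot> \<alpha> = a \<cdot> p" "qe \<cdot> \<alpha> = q"
    and b: "b \<in> hom C X E" "\<beta> \<in> hom C P Q" "pe \<cdot> \<beta> = b \<cdot> p" "qe \<cdot> \<beta> = q"
    and R: "is_binary_product C A Y R r s" and t: "t \<in> hom C A X"
    and k: "k \<in> hom C R P" "p \<cdot> k = t \<cdot> r" "q \<cdot> k = s"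
  shows "a \<cdot> t = b \<cdot> t \<longleftrightarrow> ev \<cdot> (\<alpha> \<cdot> k) = ev \<cdot> (\<beta> \<cdot> k)"
proof -
  have Q: "is_binary_product C E Y Q pe qe" and ev: "ev \<in> hom C Q Z"
    using E by (auto simp: is_exponential_def)
  note D = productD[OF Q] productD[OF P] productD[OF R]
  have pe: "pe \<cdot> (\<alpha> \<cdot> k) = (a \<cdot> t) \<cdot> r" "pe \<cdot> (\<beta> \<cdot> k) = (b \<cdot> t) \<cdot> r"
    using Comp_square[OF a(3), of k] Comp_square[OF b(3), of k] a(1,2) b(1,2) k t D
    by (simp_all add: hom_iff)
  have qe: "qe \<cdot> (\<alpha> \<cdot> k) = s" "qe \<cdot> (\<beta> \<cdot> k) = s"
    using Comp_Comp_eq[OF a(4), of k] Comp_Comp_eq[OF b(4), of k] a(2) b(2) k D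
    by (simp_all add: hom_iff)
  have h: "\<alpha> \<cdot> k \<in> hom C R Q" "\<beta> \<cdot> k \<in> hom C R Q" "a \<cdot> t \<in> hom C A E" "b \<cdot> t \<in> hom C A E"
    using a(1,2) b(1,2) k(1) t by (auto simp: hom_iff)
  show ?thesis
  proof
    assume "a \<cdot> t = b \<cdot> t"
    then have "\<alpha> \<cdot> k = \<beta> \<cdot> k"
      using product_ext[OF Q h(1,2)] pe qe by simp
    then show "ev \<cdot> (\<alpha> \<cdot> k) = ev \<cdot> (\<beta> \<cdot> k)" by simp
  next
    assume "ev \<cdot> (\<alpha> \<cdot> k) = ev \<cdot> (\<beta> \<cdot> k)"
    then show "a \<cdot> t = b \<cdot> t"
      using curry_unique[OF E R h(3,1) pe(1) qe(1) h(4,2) pe(2) qe(2)] by simp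
  qed
qed

text \<open>Over \<open>x\<close> in the codomain of \<open>f : Y \<rightarrow> X\<close>, the fibre of \<open>f\<close> is a subset of \<open>Y\<close>, and
  quantification over it expresses that this subset equals its intersection with \<open>U\<close>.
  So \<open>Forall f U\<close> is the equalizer of two arrows from \<open>X\<close> to the power object of \<open>Y\<close>.\<close>

lemma rep_Forall:
  assumes U: "rep Y U" and f: "f \<in> hom C Y X"
  shows "rep X (Forall f U)"
proof -
  have O: "X \<in> Obj C" "Y \<in> Obj C" using hom_objs[OF f] by auto
  obtain u where u: "is_mono C u" "u \<in> Arr C" "Cod C u = Y" "U = below u"
    using repE[OF U] by blast
  obtain P p q where P: "is_binary_product C X Y P p q" using product_exists[OF O] by blast
  note DP = productD[OF P]
  \<comment> \<open>\<open>g = (f, id)\<close> is the graph of \<open>f\<close>, mono because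
    \<open>q\<close> retracts it.\<close>
  obtain g where g: "g \<in> hom C Y P" "p \<cdot> g = f" "q \<cdot> g = Id C Y"
    using product_pair[OF P f Id_in_hom[OF O(2)]] by blast
  have mg: "is_mono C g" using g DP by (intro split_mono[of q]) (auto simp: hom_iff)
  have gu: "is_mono C (g \<cdot> u)" using mono_Comp[OF u(1) mg] u g by (simp add: hom_iff)
  have "rep P (below g)" using rep_below[OF mg] g by (simp add: hom_iff)
  then obtain \<gamma> where \<gamma>: "\<gamma> \<in> hom C P \<Omega>" "below g = Eq \<gamma> (tt P)" by (rule classify)
  have "rep P (below (g \<cdot> u))" using rep_below[OF gu] g u by (simp add: hom_iff)
  then obtain \<delta> where \<delta>: "\<delta> \<in> hom C P \<Omega>" "below (g \<cdot> u) = Eq \<delta> (tt P)" by (rule classify)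
  obtain E Q pe qe ev where E: "is_exponential C Y \<Omega> E Q pe qe ev"
    using exponential_exists[OF O(2) Omega_Obj] by blast
  \<comment> \<open>The transpose \<open>a\<close> sends \<open>x\<close> to its fibre under
    \<open>f\<close>, and \<open>b\<close> sends \<open>x\<close> to the part of that fibre in
    \<open>U\<close>.\<close>
  obtain a \<alpha> where a: "a \<in> hom C X E" "\<alpha> \<in> hom C P Q" "pe \<cdot> \<alpha> = a \<cdot> p" "qe \<cdot> \<alpha> = q" "ev \<cdot> \<alpha> = \<gamma>"
    using curry[OF E P \<gamma>(1)] by blast
  obtain b \<beta> where b: "b \<in> hom C X E" "\<beta> \<in> hom C P Q" "pe \<cdot> \<beta> = b \<cdot> p" "qe \<cdot> \<beta> = q" "ev \<cdot> \<beta> = \<delta>"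
    using curry[OF E P \<delta>(1)] by blast
  have ev: "ev \<in> hom C Q \<Omega>" using E by (simp add: is_exponential_def)
  have "Forall f U = Eq a b"
  proof (intro set_eqI)
    fix t
    show "t \<in> Forall f U \<longleftrightarrow> t \<in> Eq a b"
    proof (cases "t \<in> into X")
      case False
      then show ?thesis using f a(1) by (simp add: Forall_def Eq_def hom_iff)
    next
      case True
      define A where "A = Dom C t"
      have t: "t \<in> hom C A X" and A: "A \<in> Obj C" using True by (auto simp: A_def into_iff hom_iff)
      obtain R r s where R: "is_binary_product C A Y R r s" using product_exists[OF A O(2)] by blast
      note DR = productD[OF R]
      have "t \<cdot> r \<in> hom C R X" "s \<in> hom C R Y" using t DR by (auto simp: hom_iff)
      then obtain k where k: "k \<in> hom C R P" "p \<cdot> k = t \<cdot> r" "q \<cdot> k = s"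
        by (rule product_pair[OF P])
      have evk: "ev \<cdot> (\<alpha> \<cdot> k) = \<gamma> \<cdot> k" "ev \<cdot> (\<beta> \<cdot> k) = \<delta> \<cdot> k"
        using Comp_Comp_eq[OF a(5), of k] Comp_Comp_eq[OF b(5), of k] a(2) b(2) k(1) ev
        by (simp_all add: hom_iff)
      have EqR: "Eq (\<gamma> \<cdot> k) (tt R) = inverse_image k (below g)"
        "Eq (\<delta> \<cdot> k) (tt R) = inverse_image k (below (g \<cdot> u))"
        unfolding \<gamma>(2) \<delta>(2) using \<gamma>(1) \<delta>(1) k(1) DR DP
        by (auto simp: Eq_def inverse_image_def hom_iff into_iff tt_Comp)
      have hR: "\<gamma> \<cdot> k \<in> hom C R \<Omega>" "\<delta> \<cdot> k \<in> hom C R \<Omega>"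
        using \<gamma>(1) \<delta>(1) k(1) by (auto simp: hom_iff)
      have "t \<in> Eq a b \<longleftrightarrow> a \<cdot> t = b \<cdot> t"
        using True a(1) by (simp add: Eq_def hom_iff)
      also have "\<dots> \<longleftrightarrow> \<gamma> \<cdot> k = \<delta> \<cdot> k"
        using transpose_eq_iff[OF E P a(1-4) b(1-4) R t k] evk by simp
      also have "\<dots> \<longleftrightarrow> inverse_image k (below g) = inverse_image k (below (g \<cdot> u))"
        using classify_unique[OF hR] EqR by auto
      also have "\<dots> \<longleftrightarrow> t \<in> Forall f U"
      proof
        assume eq: "inverse_image k (below g) = inverse_image k (below (g \<cdot> u))"
        show "t \<in> Forall f U" unfolding Forall_def
        proof (intro CollectI conjI ballI impI)
          show "t \<in> into (Cod C f)" using True f by (simp add: hom_iff)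
          fix c y assume c: "c \<in> into (Dom C t)" and y: "y \<in> into (Dom C f)" "Dom C y = Dom C c"
            "f \<cdot> y = t \<cdot> c"
          have "c \<in> hom C (Dom C c) A" "y \<in> hom C (Dom C c) Y"
            using c y f by (auto simp: A_def into_iff hom_iff)
          then obtain z where z: "z \<in> hom C (Dom C c) R" "r \<cdot> z = c" "s \<cdot> z = y"
            by (rule product_pair[OF R])
          \<comment> \<open>\<open>z = (c, y)\<close> goes under \<open>k = t \<times> Y\<close> to
            \<open>(t c, y) = (f y, y)\<close>, a point of the graph.\<close>
          have "k \<cdot> z = g \<cdot> y"
          proof (rule product_ext[OF P, of _ "Dom C c"])
            show "p \<cdot> (k \<cdot> z) = p \<cdot> (g \<cdot> y)"
              using Comp_square[OF k(2), of z] Comp_Comp_eq[OF g(2), of y] z k(1) t DP DR g(1) y f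
              by (simp add: hom_iff into_iff)
            show "q \<cdot> (k \<cdot> z) = q \<cdot> (g \<cdot> y)"
              using Comp_Comp_eq[OF k(3), of z] Comp_Comp_eq[OF g(3), of y] z k(1) DP DR g(1) y f
              by (simp add: hom_iff into_iff)
          qed (use z k(1) g(1) y f in \<open>auto simp: hom_iff into_iff\<close>)
          moreover have "g \<cdot> y \<in> below g"
            using y g(1) f by (auto simp: below_def hom_iff)
          ultimately have "z \<in> inverse_image k (below g)"
            using z k(1) by (simp add: inverse_image_def hom_iff into_iff)
          then have "z \<in> inverse_image k (below (g \<cdot> u))" using eq by simp
          then have "g \<cdot> y \<in> below (g \<cdot> u)"
            using \<open>k \<cdot> z = g \<cdot> y\<close> by (simp add: inverse_image_def)
          then show "y \<in> U"
            using Comp_in_below_iff[OF mg u(2), of y] u g(1) y f by (simp add: hom_iff)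
        qed
      next
        assume tF: "t \<in> Forall f U"
        have "z \<in> inverse_image k (below (g \<cdot> u))" if zg: "z \<in> inverse_image k (below g)" for z
        proof -
          obtain y where z: "z \<in> into R" and y: "y \<in> into Y" "k \<cdot> z = g \<cdot> y"
            using zg g(1) k(1) by (auto simp: inverse_image_def below_def hom_iff)
          have dom: "Dom C y = Dom C z"
            using y z k(1) g(1) Comp_Arr(2)[of z k] Comp_Arr(2)[of y g] by (simp add: hom_iff into_iff)
          have "t \<cdot> (r \<cdot> z) = p \<cdot> (k \<cdot> z)"
            using Comp_square[OF k(2), of z] z k(1) t DP DR by (simp add: hom_iff into_iff)
          also have "\<dots> = f \<cdot> y"
            using Comp_Comp_eq[OF g(2), of y] y DP g(1) by (simp add: hom_iff into_iff)
          finally have "y \<in> U"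
            using tF z y dom DR f t
            by (intro ForallD[of t f U "r \<cdot> z" y]) (auto simp: hom_iff into_iff)
          then have "g \<cdot> y \<in> below (g \<cdot> u)"
            using Comp_in_below_iff[OF mg u(2), of y] u g(1) y by (simp add: hom_iff)
          then show ?thesis using z y k(1) by (simp add: inverse_image_def hom_iff)
        qed
        moreover have "z \<in> inverse_image k (below g)" if "z \<in> inverse_image k (below (g \<cdot> u))" for z
          using that g(1) u by (auto simp: inverse_image_def below_def hom_iff into_iff)
        ultimately show "inverse_image k (below g) = inverse_image k (below (g \<cdot> u))" by blast
      qed
      finally show ?thesis by simp
    qed
  qed
  then show ?thesis using rep_Eq[OF a(1) b(1)] by simp
qed

text \<open>Implication is quantification along the mono for \<open>R\<close>: its fibre over
  \<open>t\<close> has at most one element, and has one exactly when \<open>t\<close> lies in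
  \<open>R\<close>.\<close>

lemma rep_Imp:
  assumes "rep W R" "rep W S"
  shows "rep W (Imp W R S)"
proof -
  obtain m where m: "is_mono C m" "m \<in> Arr C" "Cod C m = W" "R = below m"
    using repE[OF assms(1)] by blast
  have "rep W (Forall m (inverse_image m S))"
    using rep_inverse_image[OF assms(2) m(2,3)] m(2,3) by (intro rep_Forall) (auto simp: hom_iff)
  moreover have "Forall m (inverse_image m S) = Imp W R S"
  proof (intro set_eqI iffI)
    fix t assume t: "t \<in> Forall m (inverse_image m S)"
    show "t \<in> Imp W R S" unfolding Imp_def
    proof (intro CollectI conjI ballI impI)
      show tW: "t \<in> into W" using t m(3) by (simp add: Forall_def)
      fix a assume a: "a \<in> into (Dom C t)" "t \<cdot> a \<in> R"
      then obtain h where h: "h \<in> into (Dom C m)" "t \<cdot> a = m \<cdot> h"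
        using m(4) by (auto simp: below_def)
      have "Dom C h = Dom C a"
        using h m(2) a tW Comp_Arr(2)[of h m] Comp_Arr(2)[of a t] by (simp add: into_iff)
      then have "h \<in> inverse_image m S" using ForallD[OF t a(1) h(1)] h by simp
      then show "t \<cdot> a \<in> S" using h by (simp add: inverse_image_def)
    qed
  next
    fix t assume t: "t \<in> Imp W R S"
    then show "t \<in> Forall m (inverse_image m S)"
      unfolding Forall_def inverse_image_def using m(3,4)
      by (auto simp: Imp_def below_def)
  qed
  ultimately show ?thesis by simp
qed

section \<open>Complemented subobjects and decidable objects\<close>

text \<open>The second-order falsity \<open>\<forall>\<omega>. \<omega>\<close>: over an empty
  object every truth value is \<open>true\<close>.\<close>

definition empty :: "'o \<Rightarrow> bool" where
  "empty A \<longleftrightarrow> A \<in> Obj C \<and> (\<forall>a \<in> into A. \<forall>\<omega> \<in> hom C (Dom C a) \<Omega>. \<omega> = tt (Dom C a))"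

definition Bottom :: "'o \<Rightarrow> 'm set" where
  "Bottom W = {t \<in> into W. empty (Dom C t)}"

definition neg :: "'o \<Rightarrow> 'm set \<Rightarrow> 'm set" where
  "neg W M = Imp W M (Bottom W)"

text \<open>Excluded middle for \<open>M\<close>. A complement is necessarily the negation, and the
  join of the two being total is expressed through their upper bounds \<open>R\<close>.\<close>

definition complemented :: "'o \<Rightarrow> 'm set \<Rightarrow> bool" where
  "complemented W M \<longleftrightarrow>
     rep W M \<and> (\<forall>R. rep W R \<longrightarrow> M \<subseteq> R \<longrightarrow> neg W M \<subseteq> R \<longrightarrow> Id C W \<in> R)"

text \<open>Ex falso: at an empty stage the classifying arrow of \<open>R\<close> can only be
  \<open>true\<close>.\<close>

lemma empty_rep:
  assumes "empty (Dom C t)" "t \<in> into W" "rep W R"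
  shows "t \<in> R"
proof -
  obtain \<chi> where \<chi>: "\<chi> \<in> hom C W \<Omega>" "R = Eq \<chi> (tt W)" using classify[OF assms(3)] by blast
  have "Id C (Dom C t) \<in> into (Dom C t)" "\<chi> \<cdot> t \<in> hom C (Dom C (Id C (Dom C t))) \<Omega>"
    using \<chi>(1) assms(2) by (auto simp: into_iff hom_iff)
  then have "\<chi> \<cdot> t = tt (Dom C (Id C (Dom C t)))"
    using assms(1) unfolding empty_def by blast
  then show ?thesis using \<chi> assms(2) by (simp add: Eq_def into_iff hom_iff tt_Comp)
qed

lemma empty_Dom: "empty A \<Longrightarrow> a \<in> into A \<Longrightarrow> empty (Dom C a)"
  unfolding empty_def
proof (intro conjI ballI)
  fix b \<omega>
  assume A: "A \<in> Obj C \<and> (\<forall>a \<in> into A. \<forall>\<omega> \<in> hom C (Dom C a) \<Omega>. \<omega> = tt (Dom C a))"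
    and a: "a \<in> into A" and b: "b \<in> into (Dom C a)" "\<omega> \<in> hom C (Dom C b) \<Omega>"
  then have "a \<cdot> b \<in> into A" "Dom C (a \<cdot> b) = Dom C b" by (auto simp: into_iff)
  then show "\<omega> = tt (Dom C b)" using A b(2) by metis
qed (simp add: into_iff)

text \<open>Falsity is formed by quantifying the predicate \<open>\<omega> = true\<close> along the
  projection from \<open>W \<times> \<Omega>\<close> to \<open>W\<close>.\<close>

lemma rep_Bottom:
  assumes W: "W \<in> Obj C"
  shows "rep W (Bottom W)"
proof -
  obtain P p q where P: "is_binary_product C W \<Omega> P p q"
    using product_exists[OF W Omega_Obj] by blast
  note D = productD[OF P]
  have "rep P (Eq q (tt P))" using D by (intro rep_Eq[of _ _ \<Omega>]) (auto simp: hom_iff)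
  then have "rep W (Forall p (Eq q (tt P)))" using D by (intro rep_Forall) (auto simp: hom_iff)
  moreover have "Forall p (Eq q (tt P)) = Bottom W"
  proof (intro set_eqI iffI)
    fix t assume t: "t \<in> Forall p (Eq q (tt P))"
    then have tW: "t \<in> into W" using D by (simp add: Forall_def)
    moreover have "\<omega> = tt (Dom C a)" if a: "a \<in> into (Dom C t)" "\<omega> \<in> hom C (Dom C a) \<Omega>" for a \<omega>
    proof -
      have "t \<cdot> a \<in> hom C (Dom C a) W" using a tW by (simp add: into_iff hom_iff)
      then obtain y where y: "y \<in> hom C (Dom C a) P" "p \<cdot> y = t \<cdot> a" "q \<cdot> y = \<omega>"
        using product_pair[OF P _ a(2)] by blast
      then have "y \<in> Eq q (tt P)"
        using D a by (intro ForallD[OF t, of a]) (auto simp: into_iff hom_iff)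
      then show ?thesis using y D by (simp add: Eq_def hom_iff tt_Comp)
    qed
    ultimately show "t \<in> Bottom W" by (auto simp: Bottom_def empty_def into_iff)
  next
    fix t assume t: "t \<in> Bottom W"
    show "t \<in> Forall p (Eq q (tt P))" unfolding Forall_def
    proof (intro CollectI conjI ballI impI)
      show "t \<in> into (Cod C p)" using t D by (simp add: Bottom_def)
      fix a y assume a: "a \<in> into (Dom C t)" "y \<in> into (Dom C p)" "Dom C y = Dom C a"
      have "q \<cdot> y \<in> hom C (Dom C a) \<Omega>" using a D by (simp add: hom_iff into_iff)
      then have "q \<cdot> y = tt (Dom C a)" using t a unfolding Bottom_def empty_def by blast
      then show "y \<in> Eq q (tt P)" using a D by (simp add: Eq_def into_iff tt_Comp)
    qed
  qed
  ultimately show ?thesis by simp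
qed

lemma rep_neg: "rep W M \<Longrightarrow> rep W (neg W M)"
  unfolding neg_def by (intro rep_Imp rep_Bottom) (auto dest: rep_Obj)

lemma negD: "t \<in> neg W M \<Longrightarrow> a \<in> into (Dom C t) \<Longrightarrow> t \<cdot> a \<in> M \<Longrightarrow> empty (Dom C a)"
  using ImpD[of t W M "Bottom W" a] by (auto simp: neg_def Bottom_def Imp_def into_iff)

lemma negI:
  assumes "t \<in> into W" "\<And>a. a \<in> into (Dom C t) \<Longrightarrow> t \<cdot> a \<in> M \<Longrightarrow> empty (Dom C a)"
  shows "t \<in> neg W M"
  using assms by (auto simp: neg_def Bottom_def Imp_def into_iff)

lemma neg_into: "t \<in> neg W M \<Longrightarrow> t \<in> into W"
  by (simp add: neg_def Imp_def)

lemma neg_antimono: "M \<subseteq> M' \<Longrightarrow> neg W M' \<subseteq> neg W M"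
  by (auto simp: neg_def Imp_def)

lemma complementedD:
  "complemented W M \<Longrightarrow> rep W R \<Longrightarrow> M \<subseteq> R \<Longrightarrow> neg W M \<subseteq> R \<Longrightarrow> Id C W \<in> R"
  by (simp add: complemented_def)

text \<open>The meet of \<open>m\<close> and \<open>n\<close> is least, hence below falsity, so its
  domain is empty and \<open>n\<close> lies in the negation of \<open>m\<close>. Upper bounds of
  \<open>m\<close> and its negation are then upper bounds of \<open>m\<close> and
  \<open>n\<close>.\<close>

lemma is_complementD:
  assumes "is_complement C X m n"
  shows "complemented X (below m)"
proof -
  have m: "is_mono C m" "m \<in> Arr C" "Cod C m = X" and n: "is_mono C n" "n \<in> Arr C" "Cod C n = X"
    using assms mono_Arr by (auto simp: is_complement_def monos_into_iff)
  have X: "X \<in> Obj C" using m by auto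
  have rm: "rep X (below m)" and rn: "rep X (below n)" using m n by (auto intro: rep_below)
  obtain l where l: "is_mono C l" "l \<in> Arr C" "Cod C l = X" "below m \<inter> below n = below l"
    using repE[OF rep_Int[OF rm rn]] by blast
  obtain k where k: "is_mono C k" "k \<in> Arr C" "Cod C k = X" "Bottom X = below k"
    using repE[OF rep_Bottom[OF X]] by blast
  have "sub_le C l m" "sub_le C l n"
    using l m n below_self[OF l(2)] by (auto simp: sub_le_iff)
  moreover have "l \<in> monos_into C X" "k \<in> monos_into C X"
    using l k by (auto simp: monos_into_iff)
  ultimately have "sub_le C l k"
    using assms unfolding is_complement_def by blast
  then have el: "empty (Dom C l)"
    using l k by (auto simp: sub_le_iff Bottom_def)
  have "below n \<subseteq> neg X (below m)"
  proof (intro subsetI negI)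
    fix t a assume t: "t \<in> below n" and a: "a \<in> into (Dom C t)" "t \<cdot> a \<in> below m"
    have tX: "t \<in> into X" using rep_into[OF rn t] .
    have "t \<cdot> a \<in> below l" using rep_closed[OF rn t a(1)] a(2) l(4) by blast
    then obtain h where h: "h \<in> into (Dom C l)" "t \<cdot> a = l \<cdot> h" by (auto simp: below_def)
    have "Dom C h = Dom C a"
      using h l(2) a tX Comp_Arr(2)[of h l] Comp_Arr(2)[of a t] by (simp add: into_iff)
    then show "empty (Dom C a)" using empty_Dom[OF el h(1)] by simp
  qed (rule rep_into[OF rn])
  moreover have "Id C X \<in> R" if R: "rep X R" "below m \<subseteq> R" "below n \<subseteq> R" for R
  proof -
    obtain u where u: "is_mono C u" "u \<in> Arr C" "Cod C u = X" "R = below u"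
      using repE[OF R(1)] by blast
    have "sub_le C m u" "sub_le C n u"
      using below_self[OF m(2)] below_self[OF n(2)] R m n u by (auto simp: sub_le_iff)
    moreover have "u \<in> monos_into C X" "Id C X \<in> monos_into C X"
      using u X mono_Id[OF X] by (auto simp: monos_into_iff)
    ultimately have "sub_le C (Id C X) u"
      using assms unfolding is_complement_def by blast
    then show ?thesis using u X by (simp add: sub_le_iff)
  qed
  ultimately show ?thesis unfolding complemented_def using rm by blast
qed

text \<open>The negation is the witness: a subobject below both has empty domain and so lies below
  every other one.\<close>

lemma complemented_is_complement:
  assumes m: "is_mono C m" "Cod C m = X" and M: "complemented X (below m)"
  obtains n where "is_complement C X m n"
proof -
  have A: "m \<in> Arr C" using mono_Arr[OF m(1)] .
  have X: "X \<in> Obj C" using A m by auto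
  have rm: "rep X (below m)" using M by (simp add: complemented_def)
  obtain n where n: "is_mono C n" "n \<in> Arr C" "Cod C n = X" "neg X (below m) = below n"
    using repE[OF rep_neg[OF rm]] by blast
  have "is_complement C X m n"
    unfolding is_complement_def
  proof (intro conjI ballI impI)
    show "m \<in> monos_into C X" "n \<in> monos_into C X" using m n by (auto simp: monos_into_iff)
    fix l k assume l: "l \<in> monos_into C X" "sub_le C l m \<and> sub_le C l n" and k: "k \<in> monos_into C X"
    have K: "l \<in> Arr C" "Cod C l = X" "is_mono C k" "k \<in> Arr C" "Cod C k = X"
      using l k mono_Arr by (auto simp: monos_into_iff)
    have "l \<in> below m" "l \<in> neg X (below m)" using l K A m n by (auto simp: sub_le_iff)
    then have "empty (Dom C l)"
      using negD[of l X "below m" "Id C (Dom C l)"] K by (simp add: into_iff)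
    then have "l \<in> below k" using K rep_below[OF K(3,5)] empty_rep[of l X "below k"] by (simp add: into_iff)
    then show "sub_le C l k" using K by (simp add: sub_le_iff)
  next
    fix u k assume u: "u \<in> monos_into C X" "sub_le C m u \<and> sub_le C n u" and k: "k \<in> monos_into C X"
    have K: "is_mono C u" "u \<in> Arr C" "Cod C u = X" "is_mono C k" "k \<in> Arr C" "Cod C k = X"
      using u k mono_Arr by (auto simp: monos_into_iff)
    have ru: "rep X (below u)" using rep_below K by blast
    have mu: "m \<in> below u" "n \<in> below u" using u K A m n by (auto simp: sub_le_iff)
    have "below m \<subseteq> below u" "below n \<subseteq> below u"
      using rep_closed[OF ru mu(1)] rep_closed[OF ru mu(2)] by (auto simp: below_def)
    then have "Id C X \<in> below u" using complementedD[OF M ru] n(4) by simp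
    then have "k \<in> below u" using rep_total[OF ru, of k] K by (simp add: into_iff)
    then show "sub_le C k u" using K by (simp add: sub_le_iff)
  qed
  then show ?thesis by (rule that)
qed

text \<open>An upper bound \<open>R\<close> on \<open>Y\<close> is moved to the upper bound
  \<open>Forall f R\<close> on \<open>X\<close> by adjunction; there excluded middle for
  \<open>M\<close> applies.\<close>

lemma complemented_inverse_image:
  assumes M: "complemented X M" and f: "f \<in> hom C Y X"
  shows "complemented Y (inverse_image f M)"
proof -
  have rM: "rep X M" using M by (simp add: complemented_def)
  have rI: "rep Y (inverse_image f M)" using rep_inverse_image[OF rM, of f] f by (simp add: hom_iff)
  have "Id C Y \<in> R" if R: "rep Y R" "inverse_image f M \<subseteq> R" "neg Y (inverse_image f M) \<subseteq> R" for R
  proof -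
    have "M \<subseteq> Forall f R"
    proof
      fix t assume t: "t \<in> M"
      show "t \<in> Forall f R" unfolding Forall_def
      proof (intro CollectI conjI ballI impI)
        show "t \<in> into (Cod C f)" using rep_into[OF rM t] f by (simp add: hom_iff)
        fix a y assume a: "a \<in> into (Dom C t)" "y \<in> into (Dom C f)" "f \<cdot> y = t \<cdot> a"
        then have "y \<in> inverse_image f M"
          using rep_closed[OF rM t a(1)] by (simp add: inverse_image_def)
        then show "y \<in> R" using R by blast
      qed
    qed
    moreover have "neg X M \<subseteq> Forall f R"
    proof
      fix t assume t: "t \<in> neg X M"
      show "t \<in> Forall f R" unfolding Forall_def
      proof (intro CollectI conjI ballI impI)
        show "t \<in> into (Cod C f)" using neg_into[OF t] f by (simp add: hom_iff)
        fix a y assume a: "a \<in> into (Dom C t)" "y \<in> into (Dom C f)" "Dom C y = Dom C a"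
          "f \<cdot> y = t \<cdot> a"
        have "y \<in> neg Y (inverse_image f M)"
        proof (rule negI)
          show "y \<in> into Y" using a f by (simp add: hom_iff)
          fix b assume b: "b \<in> into (Dom C y)" "y \<cdot> b \<in> inverse_image f M"
          have "f \<cdot> (y \<cdot> b) = t \<cdot> (a \<cdot> b)"
            using Comp_square[OF a(4), of b] a(1-3) b(1) f neg_into[OF t]
            by (simp add: into_iff hom_iff)
          then show "empty (Dom C b)"
            using b a(1,3) negD[OF t, of "a \<cdot> b"] by (simp add: inverse_image_def into_iff)
        qed
        then show "y \<in> R" using R by blast
      qed
    qed
    ultimately have "Id C X \<in> Forall f R"
      using complementedD[OF M rep_Forall[OF R(1) f]] by blast
    \<comment> \<open>The total subobject is specialised to the change of stage \<open>f\<close> and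
      the element \<open>Id C Y\<close> of the fibre over it.\<close>
    then show ?thesis
      by (rule ForallD[of _ f R f]) (use f hom_objs[OF f] in \<open>auto simp: hom_iff into_iff\<close>)
  qed
  then show ?thesis unfolding complemented_def using rI by blast
qed

text \<open>Two case distinctions. Splitting on \<open>N\<close>, with the implication from
  \<open>M\<close> to \<open>R\<close> as upper bound, gives \<open>M \<subseteq> R\<close>;
  splitting on \<open>M\<close> then makes \<open>R\<close> total.\<close>

lemma complemented_Int:
  assumes M: "complemented W M" and N: "complemented W N"
  shows "complemented W (M \<inter> N)"
proof -
  have r: "rep W M" "rep W N" using M N by (auto simp: complemented_def)
  have "Id C W \<in> R" if R: "rep W R" "M \<inter> N \<subseteq> R" "neg W (M \<inter> N) \<subseteq> R" for R
  proof -
    have "N \<subseteq> Imp W M R"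
      using R(2) rep_into[OF r(2)] rep_closed[OF r(2)] by (auto simp: Imp_def)
    moreover have "neg W N \<subseteq> Imp W M R"
      using R(3) neg_antimono[of "M \<inter> N" N W] rep_closed[OF R(1)] by (auto simp: Imp_def neg_into)
    ultimately have I: "Id C W \<in> Imp W M R"
      using complementedD[OF N rep_Imp[OF r(1) R(1)]] by blast
    have "M \<subseteq> R"
    proof
      fix t assume t: "t \<in> M"
      then show "t \<in> R"
        using ImpD[OF I, of t] rep_into[OF r(1) t] rep_Obj[OF r(1)] by (simp add: into_iff)
    qed
    moreover have "neg W M \<subseteq> R" using R(3) neg_antimono[of "M \<inter> N" M W] by blast
    ultimately show ?thesis using complementedD[OF M R(1)] by blast
  qed
  then show ?thesis unfolding complemented_def using rep_Int[OF r] by blast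
qed

lemma complemented_into: "W \<in> Obj C \<Longrightarrow> complemented W (into W)"
  unfolding complemented_def using rep_into_self by (auto simp: into_iff)

text \<open>The diagonal is the universal equality, given by the two projections, and complements
  are stable under pullback. This form does not depend on a chosen product.\<close>

lemma decidable_iff:
  "decidable C D \<longleftrightarrow>
     D \<in> Obj C \<and> (\<forall>W. \<forall>f \<in> hom C W D. \<forall>g \<in> hom C W D. complemented W (Eq f g))"
proof (intro iffI conjI allI ballI)
  assume dec: "decidable C D"
  then show "D \<in> Obj C" by (simp add: decidable_def)
  fix W f g assume fg: "f \<in> hom C W D" "g \<in> hom C W D"
  obtain P p q d n where P: "is_binary_product C D D P p q"
    and d: "d \<in> hom C D P" "p \<cdot> d = Id C D" "q \<cdot> d = Id C D" and n: "is_complement C P d n"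
    using dec unfolding decidable_def by blast
  obtain h where h: "h \<in> hom C W P" "p \<cdot> h = f" "q \<cdot> h = g"
    using product_pair[OF P fg] by blast
  have "complemented P (Eq p q)" using is_complementD[OF n] below_diagonal[OF P d] by simp
  from complemented_inverse_image[OF this h(1)] show "complemented W (Eq f g)"
    using inverse_image_diagonal[OF P h] by simp
next
  assume "D \<in> Obj C \<and> (\<forall>W. \<forall>f \<in> hom C W D. \<forall>g \<in> hom C W D. complemented W (Eq f g))"
  then have D: "D \<in> Obj C" and
    c: "\<And>W f g. f \<in> hom C W D \<Longrightarrow> g \<in> hom C W D \<Longrightarrow> complemented W (Eq f g)"
    by auto
  obtain P p q where P: "is_binary_product C D D P p q" using product_exists[OF D D] by blast
  note DP = productD[OF P]
  obtain d where d: "d \<in> hom C D P" "p \<cdot> d = Id C D" "q \<cdot> d = Id C D"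
    using product_pair[OF P Id_in_hom[OF D] Id_in_hom[OF D]] by blast
  have "is_mono C d" using d DP by (intro split_mono[of p]) (auto simp: hom_iff)
  moreover have "complemented P (below d)"
    using c[of p P q] DP below_diagonal[OF P d] by (simp add: hom_iff)
  ultimately obtain n where "is_complement C P d n"
    using complemented_is_complement[of d P] d by (auto simp: hom_iff)
  then show "decidable C D" unfolding decidable_def using D P d by blast
qed

lemma decidable_Obj: "decidable C D \<Longrightarrow> D \<in> Obj C"
  by (simp add: decidable_def)

text \<open>Equality in \<open>I\<close> is equality in \<open>D\<close> after
  \<open>m\<close>.\<close>

lemma decidable_mono:
  assumes m: "is_mono C m" "m \<in> hom C I D" and D: "decidable C D"
  shows "decidable C I"
  unfolding decidable_iff
proof (intro conjI allI ballI)
  show "I \<in> Obj C" using m hom_objs by blast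
  fix W f g assume fg: "f \<in> hom C W I" "g \<in> hom C W I"
  have "complemented W (Eq (m \<cdot> f) (m \<cdot> g))"
    using D fg m Comp_in_hom unfolding decidable_iff by blast
  moreover have "Eq (m \<cdot> f) (m \<cdot> g) = Eq f g"
  proof -
    have "m \<cdot> (f \<cdot> t) = m \<cdot> (g \<cdot> t) \<longleftrightarrow> f \<cdot> t = g \<cdot> t" if "t \<in> into W" for t
      using monoD[OF m(1), of "f \<cdot> t" "g \<cdot> t" "Dom C t"] that fg m(2)
      by (auto simp: hom_iff into_iff)
    then show ?thesis using fg m(2) by (auto simp: Eq_def hom_iff into_iff)
  qed
  ultimately show "complemented W (Eq f g)" by simp
qed

text \<open>Equality of pairs is the intersection of the equalities of coordinates.\<close>

lemma decidable_product:
  assumes P: "is_binary_product C X Y P p q" and X: "decidable C X" and Y: "decidable C Y"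
  shows "decidable C P"
  unfolding decidable_iff
proof (intro conjI allI ballI)
  note D = productD[OF P]
  show "P \<in> Obj C" using D by blast
  fix W f g assume fg: "f \<in> hom C W P" "g \<in> hom C W P"
  have h: "p \<cdot> f \<in> hom C W X" "p \<cdot> g \<in> hom C W X" "q \<cdot> f \<in> hom C W Y" "q \<cdot> g \<in> hom C W Y"
    using fg D by (auto simp: hom_iff)
  then have "complemented W (Eq (p \<cdot> f) (p \<cdot> g) \<inter> Eq (q \<cdot> f) (q \<cdot> g))"
    using X Y complemented_Int unfolding decidable_iff by blast
  moreover have "Eq (p \<cdot> f) (p \<cdot> g) \<inter> Eq (q \<cdot> f) (q \<cdot> g) = Eq f g"
  proof -
    have "p \<cdot> (f \<cdot> t) = p \<cdot> (g \<cdot> t) \<and> q \<cdot> (f \<cdot> t) = q \<cdot> (g \<cdot> t) \<longleftrightarrow> f \<cdot> t = g \<cdot> t" if "t \<in> into W" for t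
      using product_ext[OF P, of "f \<cdot> t" "Dom C t" "g \<cdot> t"] that fg
      by (auto simp: hom_iff into_iff)
    then have "{t \<in> into W. p \<cdot> (f \<cdot> t) = p \<cdot> (g \<cdot> t) \<and> q \<cdot> (f \<cdot> t) = q \<cdot> (g \<cdot> t)} =
        {t \<in> into W. f \<cdot> t = g \<cdot> t}" by blast
    moreover have "Eq (p \<cdot> f) (p \<cdot> g) \<inter> Eq (q \<cdot> f) (q \<cdot> g) =
        {t \<in> into W. p \<cdot> (f \<cdot> t) = p \<cdot> (g \<cdot> t) \<and> q \<cdot> (f \<cdot> t) = q \<cdot> (g \<cdot> t)}"
      using fg D by (auto simp: Eq_def hom_iff into_iff)
    moreover have "Eq f g = {t \<in> into W. f \<cdot> t = g \<cdot> t}"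
      using fg by (simp add: Eq_def hom_iff)
    ultimately show ?thesis by simp
  qed
  ultimately show "complemented W (Eq f g)" by simp
qed

lemma decidable_terminal:
  assumes "is_terminal C S"
  shows "decidable C S"
  unfolding decidable_iff
proof (intro conjI allI ballI)
  show "S \<in> Obj C" using assms by (simp add: is_terminal_def)
  fix W f g assume fg: "f \<in> hom C W S" "g \<in> hom C W S"
  have W: "W \<in> Obj C" using hom_objs[OF fg(1)] by blast
  have "f = g" using assms fg W unfolding is_terminal_def by blast
  then have "Eq f g = into W" using fg by (auto simp: Eq_def hom_iff)
  then show "complemented W (Eq f g)" using complemented_into[OF W] by simp
qed

section \<open>Epimorphisms and images\<close>

lemma epiD:
  assumes "is_epi C e" "f \<cdot> e = g \<cdot> e" "f \<in> hom C (Cod C e) Z" "g \<in> hom C (Cod C e) Z"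
  shows "f = g"
  using assms unfolding is_epi_def by blast

text \<open>The classifying arrow of \<open>R\<close> and \<open>true\<close> agree after
  \<open>e\<close>, hence are equal. With the converse \<open>epiI\<close>, being epi means that a
  property of the codomain may be checked on the elements \<open>e x\<close>.\<close>

lemma epi_rep:
  assumes e: "is_epi C e" and R: "rep (Cod C e) R" "e \<in> R"
  shows "Id C (Cod C e) \<in> R"
proof -
  have A: "e \<in> Arr C" using e by (simp add: is_epi_def)
  obtain \<chi> where \<chi>: "\<chi> \<in> hom C (Cod C e) \<Omega>" "R = Eq \<chi> (tt (Cod C e))"
    using classify[OF R(1)] by blast
  have "\<chi> = tt (Cod C e)"
    by (rule epiD[OF e, of _ _ \<Omega>]) (use \<chi> R(2) A in \<open>auto simp: Eq_def hom_iff\<close>)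
  then show ?thesis using \<chi> A by (simp add: Eq_def into_iff)
qed

lemma epiI:
  assumes e: "e \<in> Arr C" and R: "\<And>R. rep (Cod C e) R \<Longrightarrow> e \<in> R \<Longrightarrow> Id C (Cod C e) \<in> R"
  shows "is_epi C e"
  unfolding is_epi_def
proof (intro conjI allI ballI impI)
  fix Z f g assume fg: "f \<in> hom C (Cod C e) Z" "g \<in> hom C (Cod C e) Z" "f \<cdot> e = g \<cdot> e"
  have "Id C (Cod C e) \<in> Eq f g"
    using rep_Eq[OF fg(1,2)] fg e by (intro R) (auto simp: Eq_def into_iff hom_iff)
  then show "f = g" using fg by (simp add: Eq_def hom_iff)
qed (rule e)

text \<open>One coordinate at a time, through \<open>M = S \<times> Y\<close>. That
  \<open>(s, e' y)\<close> lies in \<open>R\<close> for all \<open>y\<close> is a property of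
  \<open>s\<close>, checked at \<open>s = e x\<close>; that \<open>(s, s')\<close> lies in
  \<open>R\<close> for all \<open>s\<close> is a property of \<open>s'\<close>, checked at
  \<open>s' = e' y\<close>.\<close>

lemma epi_product:
  assumes e: "is_epi C e" "e \<in> hom C X S" and e': "is_epi C e'" "e' \<in> hom C Y S'"
    and P: "is_binary_product C X Y P p q" and Q: "is_binary_product C S S' Q r s"
    and k: "k \<in> hom C P Q" "r \<cdot> k = e \<cdot> p" "s \<cdot> k = e' \<cdot> q"
  shows "is_epi C k"
proof (rule epiI)
  show "k \<in> Arr C" using k by (simp add: hom_iff)
  fix R assume R: "rep (Cod C k) R" "k \<in> R"
  have O: "S \<in> Obj C" "Y \<in> Obj C" using e(2) e'(2) hom_objs by blast+
  obtain M p1 q1 where M: "is_binary_product C S Y M p1 q1" using product_exists[OF O] by blast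
  note D = productD[OF P] productD[OF Q] productD[OF M]
  have "p1 \<in> hom C M S" "e' \<cdot> q1 \<in> hom C M S'" using D e' by (auto simp: hom_iff)
  then obtain l where l: "l \<in> hom C M Q" "r \<cdot> l = p1" "s \<cdot> l = e' \<cdot> q1"
    by (rule product_pair[OF Q])
  have rR: "rep Q R" using R k by (simp add: hom_iff)
  define U where "U = Forall p1 (inverse_image l R)"
  have "rep S U"
    using rep_inverse_image[OF rR, of l] l(1) D unfolding U_def by (intro rep_Forall) (auto simp: hom_iff)
  moreover have "e \<in> U" unfolding U_def Forall_def
  proof (intro CollectI conjI ballI impI)
    show "e \<in> into (Cod C p1)" using e D by (simp add: hom_iff into_iff)
    fix a z assume a: "a \<in> into (Dom C e)" "z \<in> into (Dom C p1)" "Dom C z = Dom C a"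
      "p1 \<cdot> z = e \<cdot> a"
    have "a \<in> hom C (Dom C a) X" "q1 \<cdot> z \<in> hom C (Dom C a) Y"
      using a e D by (auto simp: hom_iff into_iff)
    then obtain w where w: "w \<in> hom C (Dom C a) P" "p \<cdot> w = a" "q \<cdot> w = q1 \<cdot> z"
      by (rule product_pair[OF P])
    have "k \<cdot> w = l \<cdot> z"
    proof (rule product_ext[OF Q, of _ "Dom C a"])
      show "r \<cdot> (k \<cdot> w) = r \<cdot> (l \<cdot> z)"
        using Comp_square[OF k(2), of w] Comp_Comp_eq[OF l(2), of z] k(1) l(1) w a e D
        by (simp add: hom_iff into_iff)
      show "s \<cdot> (k \<cdot> w) = s \<cdot> (l \<cdot> z)"
        using Comp_square[OF k(3), of w] Comp_square[OF l(3), of z] k(1) l(1) w a e' D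
        by (simp add: hom_iff into_iff)
    qed (use k(1) l(1) w a D in \<open>auto simp: hom_iff into_iff\<close>)
    moreover have "k \<cdot> w \<in> R"
      using rep_closed[OF R, of w] w k(1) by (simp add: hom_iff into_iff)
    ultimately show "z \<in> inverse_image l R"
      using a l(1) D by (simp add: inverse_image_def hom_iff)
  qed
  ultimately have "Id C S \<in> U" using epi_rep[OF e(1), of U] e(2) by (simp add: hom_iff)
  then have "Id C M \<in> inverse_image l R"
    unfolding U_def by (rule ForallD[of _ _ _ p1]) (use D in \<open>auto simp: into_iff\<close>)
  then have lR: "l \<in> R" using l(1) D by (simp add: inverse_image_def hom_iff)
  have "e' \<in> Forall s R" unfolding Forall_def
  proof (intro CollectI conjI ballI impI)
    show "e' \<in> into (Cod C s)" using e' D by (simp add: hom_iff into_iff)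
    fix a z assume a: "a \<in> into (Dom C e')" "z \<in> into (Dom C s)" "Dom C z = Dom C a"
      "s \<cdot> z = e' \<cdot> a"
    have "r \<cdot> z \<in> hom C (Dom C a) S" "a \<in> hom C (Dom C a) Y"
      using a e' D by (auto simp: hom_iff into_iff)
    then obtain w where w: "w \<in> hom C (Dom C a) M" "p1 \<cdot> w = r \<cdot> z" "q1 \<cdot> w = a"
      by (rule product_pair[OF M])
    have "l \<cdot> w = z"
    proof (rule product_ext[OF Q, of _ "Dom C a"])
      show "r \<cdot> (l \<cdot> w) = r \<cdot> z"
        using Comp_Comp_eq[OF l(2), of w] l(1) w a D by (simp add: hom_iff into_iff)
      show "s \<cdot> (l \<cdot> w) = s \<cdot> z"
        using Comp_square[OF l(3), of w] l(1) w a e' D by (simp add: hom_iff into_iff)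
    qed (use l(1) w a D in \<open>auto simp: hom_iff into_iff\<close>)
    then show "z \<in> R"
      using rep_closed[OF rR lR, of w] w l(1) by (simp add: hom_iff into_iff)
  qed
  then have "Id C S' \<in> Forall s R"
    using epi_rep[OF e'(1), of "Forall s R"] rep_Forall[OF rR, of s S'] e'(2) D by (simp add: hom_iff)
  then have "Id C Q \<in> R"
    by (rule ForallD[of _ _ _ s]) (use D in \<open>auto simp: into_iff\<close>)
  then show "Id C (Cod C k) \<in> R" using k by (simp add: hom_iff)
qed

text \<open>The subobject \<open>G = {(s, z). \<forall>x. e x = s \<longrightarrow> z = f x}\<close> of \<open>S \<times> Z\<close> turns out to be the graph
  of the factorization: that \<open>G \<rightarrow> S\<close> is mono, and then an isomorphism, can be tested on the
  elements \<open>e x\<close> of \<open>S\<close>.\<close>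

lemma epi_factor:
  assumes e: "is_epi C e" "e \<in> hom C X S" and f: "f \<in> hom C X Z"
    and ker: "\<And>a b. a \<in> into X \<Longrightarrow> b \<in> into X \<Longrightarrow> Dom C a = Dom C b \<Longrightarrow> e \<cdot> a = e \<cdot> b \<Longrightarrow> f \<cdot> a = f \<cdot> b"
  obtains g where "g \<in> hom C S Z" "g \<cdot> e = f"
proof -
  have O: "S \<in> Obj C" "Z \<in> Obj C" "X \<in> Obj C" using e(2) f hom_objs by blast+
  obtain P p q where P: "is_binary_product C S Z P p q" using product_exists[OF O(1,2)] by blast
  note D = productD[OF P]
  obtain N p1 q1 where N: "is_binary_product C P X N p1 q1" using product_exists[OF D(9) O(3)] by blast
  note DN = productD[OF N]
  \<comment> \<open>\<open>V\<close> is the condition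
    \<open>e x = s \<longrightarrow> z = f x\<close> on triples \<open>((s, z), x)\<close>.\<close>
  define V where "V = Imp N (Eq (e \<cdot> q1) (p \<cdot> p1)) (Eq (q \<cdot> p1) (f \<cdot> q1))"
  define G where "G = Forall p1 V"
  have "rep N V" unfolding V_def
    by (intro rep_Imp rep_Eq[of _ _ S] rep_Eq[of _ _ Z]) (use e f D DN in \<open>auto simp: hom_iff\<close>)
  then have rG: "rep P G" unfolding G_def using DN by (intro rep_Forall) (auto simp: hom_iff)
  have GD: "q \<cdot> (w \<cdot> a) = f \<cdot> x" if w: "w \<in> G" and a: "a \<in> into (Dom C w)" and
    x: "x \<in> into X" "Dom C x = Dom C a" "e \<cdot> x = p \<cdot> (w \<cdot> a)" for w a x
  proof -
    have wP: "w \<in> into P" using rep_into[OF rG w] .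
    have "w \<cdot> a \<in> hom C (Dom C a) P" "x \<in> hom C (Dom C a) X"
      using wP a x by (auto simp: hom_iff into_iff)
    then obtain y where y: "y \<in> hom C (Dom C a) N" "p1 \<cdot> y = w \<cdot> a" "q1 \<cdot> y = x"
      by (rule product_pair[OF N])
    have "y \<in> V"
      using w y DN a unfolding G_def by (intro ForallD[of w p1 V a y]) (auto simp: hom_iff into_iff)
    moreover have "y \<in> Eq (e \<cdot> q1) (p \<cdot> p1)"
      using y x e D DN by (simp add: Eq_def hom_iff into_iff)
    ultimately have "y \<in> Eq (q \<cdot> p1) (f \<cdot> q1)"
      using ImpD[of y N _ _ "Id C (Dom C y)"] y a unfolding V_def by (simp add: hom_iff into_iff)
    then show ?thesis using y f D DN by (simp add: Eq_def hom_iff)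
  qed
  obtain w where w: "w \<in> hom C X P" "p \<cdot> w = e" "q \<cdot> w = f"
    using product_pair[OF P e(2) f] by blast
  \<comment> \<open>Membership of \<open>w = (e, f)\<close> is the hypothesis \<open>ker\<close>:
    \<open>e x = e a\<close> forces \<open>f x = f a\<close>.\<close>
  have "w \<in> G" unfolding G_def Forall_def
  proof (intro CollectI conjI ballI impI)
    show "w \<in> into (Cod C p1)" using w DN by (simp add: hom_iff into_iff)
    fix a y assume a: "a \<in> into (Dom C w)" "y \<in> into (Dom C p1)" "Dom C y = Dom C a"
      "p1 \<cdot> y = w \<cdot> a"
    show "y \<in> V" unfolding V_def Imp_def
    proof (intro CollectI conjI ballI impI)
      show "y \<in> into N" using a DN by simp
      fix b assume b: "b \<in> into (Dom C y)" "y \<cdot> b \<in> Eq (e \<cdot> q1) (p \<cdot> p1)"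
      have yb: "p1 \<cdot> (y \<cdot> b) = w \<cdot> (a \<cdot> b)"
        using Comp_square[OF a(4), of b] a(1-3) b(1) w(1) DN by (simp add: hom_iff into_iff)
      have pw: "p \<cdot> (w \<cdot> (a \<cdot> b)) = e \<cdot> (a \<cdot> b)" "q \<cdot> (w \<cdot> (a \<cdot> b)) = f \<cdot> (a \<cdot> b)"
        using Comp_Comp_eq[OF w(2), of "a \<cdot> b"] Comp_Comp_eq[OF w(3), of "a \<cdot> b"] a b w(1) D
        by (simp_all add: hom_iff into_iff)
      have "e \<cdot> (q1 \<cdot> (y \<cdot> b)) = e \<cdot> (a \<cdot> b)"
        using b a(1-3) e(2) D DN yb pw by (simp add: Eq_def hom_iff into_iff)
      then have "f \<cdot> (q1 \<cdot> (y \<cdot> b)) = f \<cdot> (a \<cdot> b)"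
        using a b(1) w(1) DN by (intro ker) (auto simp: hom_iff into_iff)
      then show "y \<cdot> b \<in> Eq (q \<cdot> p1) (f \<cdot> q1)"
        using b(1) a(1-3) f D DN yb pw by (simp add: Eq_def hom_iff into_iff)
    qed
  qed
  obtain m where m: "is_mono C m" "m \<in> Arr C" "Cod C m = P" "G = below m"
    using repE[OF rG] by blast
  have mG: "m \<in> G" using below_self[OF m(2)] m(4) by simp
  obtain h where h: "h \<in> into (Dom C m)" "w = m \<cdot> h"
    using \<open>w \<in> G\<close> m(4) by (auto simp: below_def)
  have hX: "h \<in> hom C X (Dom C m)"
    using h w(1) m(2) by (simp add: hom_iff into_iff)
  define g where "g = p \<cdot> m"
  have g: "g \<in> Arr C" "Dom C g = Dom C m" "Cod C g = S" using m D by (auto simp: g_def)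
  have gh: "g \<cdot> h = e" using hX h(2) w(2) m D by (simp add: g_def hom_iff)
  have mono_g: "is_mono C g" unfolding is_mono_def
  proof (intro conjI allI ballI impI)
    fix A a b assume ab: "a \<in> hom C A (Dom C g)" "b \<in> hom C A (Dom C g)" "g \<cdot> a = g \<cdot> b"
    obtain J r1 r2 where J: "is_pullback C g g J r1 r2"
      by (rule pullback_exists[of g g]) (use g in auto)
    have r: "r1 \<in> hom C J (Dom C g)" "r2 \<in> hom C J (Dom C g)" "g \<cdot> r1 = g \<cdot> r2"
      using J by (auto simp: is_pullback_def)
    \<comment> \<open>\<open>J\<close> is the kernel pair of \<open>g\<close>. \<open>R\<close> says
      of \<open>s\<close> that elements of \<open>G\<close> over \<open>s\<close> have the same
      second coordinate; over \<open>s = e c\<close> that coordinate is \<open>f c\<close>, by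
      \<open>GD\<close>.\<close>
    define R where "R = Forall (g \<cdot> r1) (Eq (q \<cdot> (m \<cdot> r1)) (q \<cdot> (m \<cdot> r2)))"
    have "rep S R" unfolding R_def
      by (intro rep_Forall[of J] rep_Eq[of _ _ Z]) (use r(1,2) g m D in \<open>auto simp: hom_iff\<close>)
    moreover have "e \<in> R" unfolding R_def Forall_def
    proof (intro CollectI conjI ballI impI)
      show "e \<in> into (Cod C (g \<cdot> r1))" using e(2) g r by (simp add: hom_iff into_iff)
      fix c y assume c: "c \<in> into (Dom C e)" "y \<in> into (Dom C (g \<cdot> r1))" "Dom C y = Dom C c"
        "(g \<cdot> r1) \<cdot> y = e \<cdot> c"
      have y: "y \<in> Arr C" "Cod C y = J" using c(2) r(1) g by (auto simp: into_iff hom_iff)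
      have "g \<cdot> (r1 \<cdot> y) = e \<cdot> c" "g \<cdot> (r2 \<cdot> y) = e \<cdot> c"
        using Comp_square[OF r(3), of y] c(4) y r(1,2) g by (simp_all add: hom_iff)
      then have "e \<cdot> c = p \<cdot> (m \<cdot> (r1 \<cdot> y))" "e \<cdot> c = p \<cdot> (m \<cdot> (r2 \<cdot> y))"
        using y r(1,2) g m D by (simp_all add: g_def hom_iff)
      then have "q \<cdot> (m \<cdot> (r1 \<cdot> y)) = f \<cdot> c" "q \<cdot> (m \<cdot> (r2 \<cdot> y)) = f \<cdot> c"
        using c(1,3) e(2) y r(1,2) g by (auto intro!: GD[OF mG] simp: hom_iff into_iff)
      then show "y \<in> Eq (q \<cdot> (m \<cdot> r1)) (q \<cdot> (m \<cdot> r2))"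
        using y r(1,2) g m D by (simp add: Eq_def hom_iff into_iff)
    qed
    ultimately have IR: "Id C S \<in> R" using epi_rep[OF e(1), of R] e(2) by (simp add: hom_iff)
    obtain y where y: "y \<in> hom C A J" "r1 \<cdot> y = a" "r2 \<cdot> y = b"
      using pullback_lift[OF J ab] by blast
    have "y \<in> Eq (q \<cdot> (m \<cdot> r1)) (q \<cdot> (m \<cdot> r2))"
      using IR unfolding R_def
      by (rule ForallD[of _ _ _ "(g \<cdot> r1) \<cdot> y"]) (use y(1) r(1) g O in \<open>auto simp: hom_iff into_iff\<close>)
    then have "q \<cdot> (m \<cdot> a) = q \<cdot> (m \<cdot> b)"
      using y r(1,2) g m D by (simp add: Eq_def hom_iff)
    moreover have "p \<cdot> (m \<cdot> a) = p \<cdot> (m \<cdot> b)"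
      using ab g m D by (simp add: g_def hom_iff)
    ultimately have "m \<cdot> a = m \<cdot> b"
      using ab g m by (intro product_ext[OF P, of "m \<cdot> a" A "m \<cdot> b"]) (auto simp: hom_iff)
    then show "a = b" using monoD[OF m(1), of a b A] ab g by simp
  qed (rule g)
  \<comment> \<open>The mono \<open>g\<close> contains the epi \<open>e\<close>, so it is total and
    has a section \<open>k\<close>.\<close>
  have "e \<in> below g" using gh hX g by (auto simp: below_def hom_iff into_iff)
  then have "Id C S \<in> below g"
    using epi_rep[OF e(1), of "below g"] rep_below[OF mono_g] g e(2) by (simp add: hom_iff)
  then obtain k where k: "k \<in> into (Dom C g)" "Id C S = g \<cdot> k" by (auto simp: below_def)
  have kS: "k \<in> hom C S (Dom C g)"
    using k(1) g k(2)[symmetric] O Comp_Arr(2)[of k g] Id_Arr(2)[OF O(1)] by (simp add: hom_iff into_iff)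
  have "g \<cdot> (k \<cdot> e) = g \<cdot> h"
    using Comp_Comp_eq[OF k(2)[symmetric], of e] kS g e(2) gh by (simp add: hom_iff)
  then have "k \<cdot> e = h"
    using monoD[OF mono_g, of "k \<cdot> e" h X] kS hX e(2) g by (simp add: hom_iff)
  then have "(q \<cdot> (m \<cdot> k)) \<cdot> e = f"
    using w(3) h kS e(2) m g D by (simp add: hom_iff)
  then show ?thesis
    using that[of "q \<cdot> (m \<cdot> k)"] kS m g D by (simp add: hom_iff)
qed

text \<open>The image is the intersection of all subobjects containing \<open>f\<close>, formed internally by
  quantifying over the power object \<open>E\<close> of \<open>Y\<close>.\<close>

lemma image_factorization:
  assumes f: "f \<in> hom C X Y"
  obtains I m e where "is_mono C m" "is_epi C e" "e \<in> hom C X I" "m \<in> hom C I Y" "m \<cdot> e = f"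
proof -
  have O: "X \<in> Obj C" "Y \<in> Obj C" using f hom_objs by blast+
  obtain E P pe qy ev where E: "is_exponential C Y \<Omega> E P pe qy ev"
    using exponential_exists[OF O(2) Omega_Obj] by blast
  have P: "is_binary_product C E Y P pe qy" and ev: "ev \<in> hom C P \<Omega>"
    using E by (auto simp: is_exponential_def)
  note D = productD[OF P]
  obtain Q pe' qx where Q: "is_binary_product C E X Q pe' qx"
    using product_exists[OF D(7) O(1)] by blast
  note DQ = productD[OF Q]
  have "pe' \<in> hom C Q E" "f \<cdot> qx \<in> hom C Q Y" using DQ f by (auto simp: hom_iff)
  then obtain k where k: "k \<in> hom C Q P" "pe \<cdot> k = pe'" "qy \<cdot> k = f \<cdot> qx"
    by (rule product_pair[OF P])
  \<comment> \<open>With \<open>E\<close> read as the set of subsets \<open>A\<close> of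
    \<open>Y\<close>, \<open>Mem\<close> is membership, \<open>H0\<close> collects the
    \<open>A\<close> containing every \<open>f x\<close>, and \<open>Im\<close> consists of the
    \<open>y\<close> that lie in every such \<open>A\<close>.\<close>
  define Mem where "Mem = Eq ev (tt P)"
  define H0 where "H0 = Forall pe' (inverse_image k Mem)"
  define H where "H = inverse_image pe H0"
  define Im where "Im = Forall qy (Imp P H Mem)"
  have rMem: "rep P Mem" unfolding Mem_def using ev D by (intro rep_Eq[of _ _ \<Omega>]) (auto simp: hom_iff)
  have "rep Q (inverse_image k Mem)" using rep_inverse_image[OF rMem, of k] k(1) by (simp add: hom_iff)
  then have rH0: "rep E H0" unfolding H0_def using DQ by (intro rep_Forall) (auto simp: hom_iff)
  then have rH: "rep P H" unfolding H_def using rep_inverse_image[OF rH0, of pe] D by simp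
  have rIm: "rep Y Im" unfolding Im_def using rep_Forall[OF rep_Imp[OF rH rMem], of qy Y] D by (simp add: hom_iff)
  have f_Im: "f \<in> Im" unfolding Im_def Forall_def
  proof (intro CollectI conjI ballI impI)
    show "f \<in> into (Cod C qy)" using f D by (simp add: hom_iff into_iff)
    fix a z assume a: "a \<in> into (Dom C f)" "z \<in> into (Dom C qy)" "Dom C z = Dom C a"
      "qy \<cdot> z = f \<cdot> a"
    show "z \<in> Imp P H Mem" unfolding Imp_def
    proof (intro CollectI conjI ballI impI)
      show "z \<in> into P" using a D by simp
      fix b assume b: "b \<in> into (Dom C z)" "z \<cdot> b \<in> H"
      have "pe \<cdot> (z \<cdot> b) \<in> hom C (Dom C b) E" "a \<cdot> b \<in> hom C (Dom C b) X"
        using a b D f by (auto simp: hom_iff into_iff)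
      then obtain w where w: "w \<in> hom C (Dom C b) Q" "pe' \<cdot> w = pe \<cdot> (z \<cdot> b)" "qx \<cdot> w = a \<cdot> b"
        by (rule product_pair[OF Q])
      have "pe \<cdot> (z \<cdot> b) \<in> H0" using b(2) by (simp add: H_def inverse_image_def)
      then have "w \<in> inverse_image k Mem" unfolding H0_def
        by (rule ForallD[of _ _ _ "Id C (Dom C b)"]) (use w a b D DQ in \<open>auto simp: hom_iff into_iff\<close>)
      moreover have "k \<cdot> w = z \<cdot> b"
      proof (rule product_ext[OF P, of _ "Dom C b"])
        show "pe \<cdot> (k \<cdot> w) = pe \<cdot> (z \<cdot> b)"
          using Comp_Comp_eq[OF k(2), of w] k(1) w D by (simp add: hom_iff)
        show "qy \<cdot> (k \<cdot> w) = qy \<cdot> (z \<cdot> b)"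
          using Comp_square[OF k(3), of w] Comp_square[OF a(4), of b] k(1) w a(1-3) b(1) f D DQ
          by (simp add: hom_iff into_iff)
      qed (use w k(1) a b D in \<open>auto simp: hom_iff into_iff\<close>)
      ultimately show "z \<cdot> b \<in> Mem" by (simp add: inverse_image_def)
    qed
  qed
  have Im_least: "y \<in> R" if R: "rep Y R" "f \<in> R" and y: "y \<in> Im" for R y
  proof -
    obtain \<chi> where \<chi>: "\<chi> \<in> hom C Y \<Omega>" "R = Eq \<chi> (tt Y)" using classify[OF R(1)] by blast
    \<comment> \<open>\<open>Y\<close> serves as \<open>T \<times> Y\<close>, so the classifying
      arrow of \<open>R\<close> curries to a global element \<open>s\<close> of the power object.
      The quantifier in \<open>Im\<close> is specialised to this \<open>s\<close>.\<close>
    have "is_binary_product C T Y Y (bang Y) (Id C Y)"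
      unfolding is_binary_product_def
    proof (intro conjI allI ballI)
      fix W a b assume ab: "a \<in> hom C W T" "b \<in> hom C W Y"
      then have "bang Y \<cdot> b = a" using O by (intro to_T_eq[of _ W]) (auto simp: hom_iff)
      then show "\<exists>!h. h \<in> hom C W Y \<and> bang Y \<cdot> h = a \<and> Id C Y \<cdot> h = b"
        using ab by (intro ex1I[of _ b] conjI) (simp_all add: hom_iff, metis Comp_Id_left)
    qed (use O in \<open>auto simp: hom_iff\<close>)
    from curry[OF E this \<chi>(1)] obtain s t where
      s: "s \<in> hom C T E" and t: "t \<in> hom C Y P" "pe \<cdot> t = s \<cdot> bang Y" "qy \<cdot> t = Id C Y" "ev \<cdot> t = \<chi>"
      by blast
    have yY: "y \<in> into Y" using rep_into[OF rIm y] .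
    have tMem: "t \<cdot> b \<in> Mem \<longleftrightarrow> b \<in> R" if "b \<in> into Y" for b
      using that Comp_Comp_eq[OF t(4), of b] t(1) \<chi> ev D
      by (simp add: Mem_def Eq_def hom_iff into_iff tt_Comp)
    have "t \<cdot> y \<in> Imp P H Mem" using y unfolding Im_def
      by (rule ForallD[of _ _ _ "Id C (Dom C y)"])
        (use yY t(1) D Comp_Comp_eq[OF t(3), of y] in \<open>auto simp: hom_iff into_iff\<close>)
    moreover have "pe \<cdot> (t \<cdot> y) \<in> H0" unfolding H0_def Forall_def
    proof (intro CollectI conjI ballI impI)
      show "pe \<cdot> (t \<cdot> y) \<in> into (Cod C pe')" using yY t(1) D DQ by (simp add: hom_iff into_iff)
      fix a z assume a: "a \<in> into (Dom C (pe \<cdot> (t \<cdot> y)))" "z \<in> into (Dom C pe')" "Dom C z = Dom C a"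
        "pe' \<cdot> z = (pe \<cdot> (t \<cdot> y)) \<cdot> a"
      have a': "a \<in> Arr C" "Cod C a = Dom C y" using a(1) yY t(1) D by (auto simp: hom_iff into_iff)
      have z: "z \<in> Arr C" "Cod C z = Q" using a(2) DQ by (auto simp: into_iff)
      have fz: "f \<cdot> (qx \<cdot> z) \<in> R"
        using rep_closed[OF R, of "qx \<cdot> z"] f DQ z by (simp add: hom_iff into_iff)
      have "k \<cdot> z = t \<cdot> (f \<cdot> (qx \<cdot> z))"
      proof (rule product_ext[OF P, of _ "Dom C z"])
        have "pe \<cdot> (k \<cdot> z) = s \<cdot> (bang Y \<cdot> (y \<cdot> a))"
          using Comp_Comp_eq[OF k(2), of z] Comp_square[OF t(2), of "y \<cdot> a"] a(4) a' z k(1) yY t(1) s D O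
          by (simp add: hom_iff into_iff)
        moreover have "pe \<cdot> (t \<cdot> (f \<cdot> (qx \<cdot> z))) = s \<cdot> (bang Y \<cdot> (f \<cdot> (qx \<cdot> z)))"
          using Comp_square[OF t(2), of "f \<cdot> (qx \<cdot> z)"] z t(1) s D DQ O f by (simp add: hom_iff)
        ultimately show "pe \<cdot> (k \<cdot> z) = pe \<cdot> (t \<cdot> (f \<cdot> (qx \<cdot> z)))"
          using a' a(3) z yY f DQ by (simp add: bang_Comp into_iff hom_iff)
        show "qy \<cdot> (k \<cdot> z) = qy \<cdot> (t \<cdot> (f \<cdot> (qx \<cdot> z)))"
          using Comp_square[OF k(3), of z] Comp_Comp_eq[OF t(3), of "f \<cdot> (qx \<cdot> z)"] z k(1) t(1) f D DQ
          by (simp add: hom_iff)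
      qed (use z k(1) t(1) f DQ in \<open>auto simp: hom_iff\<close>)
      then show "z \<in> inverse_image k Mem"
        using tMem[of "f \<cdot> (qx \<cdot> z)"] fz z k(1) f DQ by (simp add: inverse_image_def hom_iff into_iff)
    qed
    then have "t \<cdot> y \<in> H" using yY t(1) D by (simp add: H_def inverse_image_def hom_iff into_iff)
    ultimately have "t \<cdot> y \<in> Mem"
      using ImpD[of "t \<cdot> y" P H Mem "Id C (Dom C y)"] yY t(1) by (simp add: hom_iff into_iff)
    then show "y \<in> R" using tMem[OF yY] by simp
  qed
  obtain m where m: "is_mono C m" "m \<in> Arr C" "Cod C m = Y" "Im = below m"
    using repE[OF rIm] by blast
  obtain e where e: "e \<in> into (Dom C m)" "f = m \<cdot> e" using f_Im m(4) by (auto simp: below_def)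
  have eX: "e \<in> hom C X (Dom C m)" using e f m(2) by (simp add: hom_iff into_iff)
  have "is_epi C e"
  proof (rule epiI)
    show "e \<in> Arr C" using eX by (simp add: hom_iff)
    fix R assume R: "rep (Cod C e) R" "e \<in> R"
    obtain r where r: "is_mono C r" "r \<in> Arr C" "Cod C r = Cod C e" "R = below r"
      using repE[OF R(1)] by blast
    have rm: "Cod C r = Dom C m" using r eX by (simp add: hom_iff)
    \<comment> \<open>A subobject of the image that contains \<open>e\<close> is a subobject of
      \<open>Y\<close> that contains \<open>f\<close>, so by minimality it contains all of
      \<open>Im\<close>.\<close>
    have "rep Y (below (m \<cdot> r))"
      using rep_below[OF mono_Comp[OF r(1) m(1) rm]] r m rm by simp
    moreover have "f \<in> below (m \<cdot> r)"
      using Comp_in_below_iff[OF m(1) r(2) rm e(1)] R(2) r(4) e(2) by simp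
    moreover have "m \<in> Im" using below_self[OF m(2)] m(4) by simp
    ultimately have "m \<cdot> Id C (Dom C m) \<in> below (m \<cdot> r)" using Im_least m(2) by simp
    then show "Id C (Cod C e) \<in> R"
      using Comp_in_below_iff[OF m(1) r(2) rm, of "Id C (Dom C m)"] m(2) r(4) eX
      by (simp add: hom_iff into_iff)
  qed
  then show ?thesis using that[OF m(1) _ eX] m e by (simp add: hom_iff)
qed

section \<open>Decidable quotients\<close>

lemma decidable_quotientD:
  assumes "is_decidable_quotient C X S p"
  shows "decidable C S" "p \<in> hom C X S" "is_epi C p"
  using assms by (auto simp: is_decidable_quotient_def)

text \<open>The image of \<open>(p, f) : X \<rightarrow> S \<times> D\<close> is again a decidable quotient of \<open>X\<close>, so it is \<open>S\<close> by
  uniqueness.\<close>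

lemma decidable_quotient_universal:
  assumes DQO: "DQO C" and p: "is_decidable_quotient C X S p"
    and D: "decidable C D" and f: "f \<in> hom C X D"
  shows "\<exists>!g. g \<in> hom C S D \<and> g \<cdot> p = f"
proof -
  note pD = decidable_quotientD[OF p]
  obtain P r s where P: "is_binary_product C S D P r s"
    using product_exists decidable_Obj pD(1) D by blast
  note DP = productD[OF P]
  obtain h where h: "h \<in> hom C X P" "r \<cdot> h = p" "s \<cdot> h = f"
    using product_pair[OF P pD(2) f] by blast
  obtain I m e where m: "is_mono C m" "m \<in> hom C I P" and e: "is_epi C e" "e \<in> hom C X I" and me: "m \<cdot> e = h"
    using image_factorization[OF h(1)] by metis
  have rme: "r \<cdot> (m \<cdot> e) = p" "s \<cdot> (m \<cdot> e) = f"
    using me h(2,3) m(2) e(2) DP by (simp_all add: hom_iff)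
  have "is_decidable_quotient C X I e"
    unfolding is_decidable_quotient_def
  proof (intro conjI allI impI ballI)
    show "decidable C I" using decidable_mono[OF m decidable_product[OF P pD(1) D]] .
    fix B f' assume B: "is_two C B" and f': "f' \<in> hom C X B"
    then obtain g where g: "g \<in> hom C S B" "g \<cdot> p = f'"
      using p unfolding is_decidable_quotient_def by blast
    \<comment> \<open>\<open>r \<cdot> m\<close> leads from \<open>I\<close> back to
      \<open>S\<close> with \<open>r m e = p\<close>, so a factor through \<open>p\<close> yields
      one through \<open>e\<close>.\<close>
    show "\<exists>!g. g \<in> hom C I B \<and> g \<cdot> e = f'"
    proof (rule ex1I[of _ "g \<cdot> (r \<cdot> m)"])
      show "g \<cdot> (r \<cdot> m) \<in> hom C I B \<and> g \<cdot> (r \<cdot> m) \<cdot> e = f'"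
        using g rme m(2) e(2) DP by (simp add: hom_iff)
      then show "k = g \<cdot> (r \<cdot> m)" if "k \<in> hom C I B \<and> k \<cdot> e = f'" for k
        using that epiD[OF e(1), of k "g \<cdot> (r \<cdot> m)" B] e(2) by (simp add: hom_iff)
    qed
  qed (use e in auto)
  moreover have "X \<in> Obj C" using f hom_objs by blast
  \<comment> \<open>Uniqueness in (DQO) gives \<open>i\<close> from \<open>S\<close> to
    \<open>I\<close> under \<open>X\<close>; then \<open>s m i p = s m e = f\<close>.\<close>
  ultimately obtain i where i: "i \<in> hom C S I" "i \<cdot> p = e"
    using DQO p unfolding DQO_def by blast
  show ?thesis
  proof (rule ex1I[of _ "(s \<cdot> m) \<cdot> i"])
    show g: "(s \<cdot> m) \<cdot> i \<in> hom C S D \<and> (s \<cdot> m) \<cdot> i \<cdot> p = f"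
      using i rme m(2) pD(2) DP by (simp add: hom_iff)
    show "k = (s \<cdot> m) \<cdot> i" if "k \<in> hom C S D \<and> k \<cdot> p = f" for k
      using that g epiD[OF pD(3), of k "(s \<cdot> m) \<cdot> i" D] pD(2) by (simp add: hom_iff)
  qed
qed

text \<open>Every object has an arrow to \<open>T\<close>, so all are empty once \<open>T\<close>
  is, and ex falso applies.\<close>

lemma degenerate_rep:
  assumes T: "empty T" and R: "rep W R"
  shows "Id C W \<in> R"
proof -
  have W: "W \<in> Obj C" using R by (rule rep_Obj)
  have "bang W \<in> into T" using W by (simp add: into_iff)
  from empty_Dom[OF T this] show ?thesis
    using empty_rep[OF _ _ R, of "Id C W"] W by (simp add: into_iff)
qed

text \<open>The complement of the equalizer of \<open>f\<close> and \<open>g\<close> has no point unless the topos is degenerate,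
  so it is initial by (NS).\<close>

lemma points_separate:
  assumes NS: "NS C" and D: "decidable C D" and f: "f \<in> hom C A D" and g: "g \<in> hom C A D"
    and eq: "\<And>x. x \<in> hom C T A \<Longrightarrow> f \<cdot> x = g \<cdot> x"
  shows "f = g"
proof -
  have c: "complemented A (Eq f g)" using D f g unfolding decidable_iff by blast
  have rE: "rep A (Eq f g)" using c by (simp add: complemented_def)
  obtain n where n: "is_mono C n" "n \<in> Arr C" "Cod C n = A" "neg A (Eq f g) = below n"
    using repE[OF rep_neg[OF rE]] by blast
  have "Id C A \<in> Eq f g"
  proof (cases "is_initial C (Dom C n)")
    case True
    have "f \<cdot> n \<in> hom C (Dom C n) D" "g \<cdot> n \<in> hom C (Dom C n) D"
      using f g n by (auto simp: hom_iff)
    moreover have "D \<in> Obj C" using D decidable_Obj by blast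
    ultimately have "f \<cdot> n = g \<cdot> n" using True unfolding is_initial_def by blast
    then have "n \<in> Eq f g" using f n by (simp add: Eq_def hom_iff into_iff)
    then have "neg A (Eq f g) \<subseteq> Eq f g"
      unfolding n(4) using rep_closed[OF rE] by (auto simp: below_def)
    then show ?thesis using complementedD[OF c rE] by blast
  next
    case False
    then obtain S x where S: "is_terminal C S" "x \<in> hom C S (Dom C n)"
      using NS n(2) unfolding NS_def by (meson Dom_in_Obj)
    \<comment> \<open>The point from (NS) may live on another terminal object; \<open>b\<close>
      moves it to \<open>T\<close>.\<close>
    then obtain b where b: "b \<in> hom C T S" unfolding is_terminal_def using T_Obj by blast
    have nx: "n \<cdot> (x \<cdot> b) \<in> hom C T A" using n S b by (simp add: hom_iff)
    have "n \<cdot> (x \<cdot> b) \<in> below n" using S b by (auto simp: below_def hom_iff into_iff)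
    moreover have "n \<cdot> (x \<cdot> b) \<in> Eq f g" using eq[OF nx] nx f by (simp add: Eq_def hom_iff into_iff)
    \<comment> \<open>A point lying in \<open>Eq f g\<close> and in its negation makes its own stage
      empty.\<close>
    ultimately have "empty T"
      using negD[of "n \<cdot> (x \<cdot> b)" A "Eq f g" "Id C T"] n(4) nx by (simp add: hom_iff into_iff)
    then show ?thesis using degenerate_rep rE by blast
  qed
  then show ?thesis using f g by (simp add: Eq_def hom_iff)
qed

text \<open>The induction step for finite products, in both directions: to build a product and to
  take apart a given one. The projections of \<open>Q\<close> are jointly monic, so conditions on
  the first \<open>n\<close> coordinates become one equation for \<open>u\<close>.\<close>

lemma finite_product_Suc_iff:
  assumes Q: "is_finite_product C n X Q \<rho>" and u: "u \<in> hom C P Q"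
    and \<pi>: "\<And>i. i < n \<Longrightarrow> \<pi> i = \<rho> i \<cdot> u"
  shows "is_finite_product C (Suc n) X P \<pi> \<longleftrightarrow> is_binary_product C Q (X n) P u (\<pi> n)"
proof
  have \<rho>: "\<rho> i \<in> hom C Q (X i)" if "i < n" for i using Q that by (simp add: is_finite_product_def)
  have ext: "a = b" if "a \<in> hom C W Q" "b \<in> hom C W Q" "\<And>i. i < n \<Longrightarrow> \<rho> i \<cdot> a = \<rho> i \<cdot> b" for W a b
  proof -
    have "W \<in> Obj C" "\<And>i. i < n \<Longrightarrow> \<rho> i \<cdot> a \<in> hom C W (X i)"
      using that(1) \<rho> hom_objs Comp_in_hom by blast+
    then have "\<exists>!h. h \<in> hom C W Q \<and> (\<forall>i<n. \<rho> i \<cdot> h = \<rho> i \<cdot> a)"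
      using finite_product_ex1[OF Q, of W "\<lambda>i. \<rho> i \<cdot> a"] by simp
    moreover have "\<forall>i<n. \<rho> i \<cdot> b = \<rho> i \<cdot> a" using that(3) by simp
    ultimately show ?thesis using that(1,2) by blast
  qed
  have assoc_\<rho>: "\<pi> i \<cdot> h = \<rho> i \<cdot> (u \<cdot> h)" if "i < n" "h \<in> hom C W P" for i h W
    using \<pi>[OF that(1)] \<rho>[OF that(1)] u that(2) by (simp add: hom_iff)
  {
    assume P: "is_finite_product C (Suc n) X P \<pi>"
    show "is_binary_product C Q (X n) P u (\<pi> n)"
      unfolding is_binary_product_def
    proof (intro conjI allI ballI)
      show "u \<in> hom C P Q" "\<pi> n \<in> hom C P (X n)" using u P by (auto simp: is_finite_product_def)
      fix W a b assume ab: "a \<in> hom C W Q" "b \<in> hom C W (X n)"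
      define f where "f i = (if i < n then \<rho> i \<cdot> a else b)" for i
      have "W \<in> Obj C" using ab hom_objs by blast
      moreover have "\<forall>i<Suc n. f i \<in> hom C W (X i)"
        using ab \<rho> by (auto simp: f_def less_Suc_eq hom_iff)
      ultimately have h: "\<exists>!h. h \<in> hom C W P \<and> (\<forall>i<Suc n. \<pi> i \<cdot> h = f i)"
        using finite_product_ex1[OF P] by simp
      have "(\<forall>i<Suc n. \<pi> i \<cdot> h = f i) \<longleftrightarrow> u \<cdot> h = a \<and> \<pi> n \<cdot> h = b" if "h \<in> hom C W P" for h
      proof -
        have "u \<cdot> h \<in> hom C W Q" using u that by (simp add: hom_iff)
        then have "(\<forall>i<n. \<rho> i \<cdot> (u \<cdot> h) = \<rho> i \<cdot> a) \<longleftrightarrow> u \<cdot> h = a"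
          using ext[OF _ ab(1), of "u \<cdot> h"] by auto
        then show ?thesis using assoc_\<rho>[OF _ that] by (auto simp: f_def less_Suc_eq)
      qed
      then show "\<exists>!h. h \<in> hom C W P \<and> u \<cdot> h = a \<and> \<pi> n \<cdot> h = b"
        using h by (metis (no_types, lifting))
    qed
  next
    assume P: "is_binary_product C Q (X n) P u (\<pi> n)"
    show "is_finite_product C (Suc n) X P \<pi>"
      unfolding is_finite_product_def
    proof (intro conjI allI ballI impI)
      show "P \<in> Obj C" using productD(9)[OF P] .
      show "\<pi> i \<in> hom C P (X i)" if "i < Suc n" for i
        using that \<pi> \<rho> u P by (auto simp: less_Suc_eq is_binary_product_def hom_iff)
      fix W f assume W: "W \<in> Obj C" and f: "\<forall>i<Suc n. f i \<in> hom C W (X i)"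
      then obtain a where a: "a \<in> hom C W Q" "\<forall>i<n. \<rho> i \<cdot> a = f i"
        using finite_product_ex1[OF Q W, of f] by auto
      obtain h where h: "h \<in> hom C W P" "u \<cdot> h = a" "\<pi> n \<cdot> h = f n"
        using product_pair[OF P a(1), of "f n"] f by blast
      show "\<exists>!h. h \<in> hom C W P \<and> (\<forall>i<Suc n. \<pi> i \<cdot> h = f i)"
      proof (rule ex1I[of _ h])
        show "h \<in> hom C W P \<and> (\<forall>i<Suc n. \<pi> i \<cdot> h = f i)"
          using h a assoc_\<rho>[OF _ h(1)] by (auto simp: less_Suc_eq)
        fix k assume k: "k \<in> hom C W P \<and> (\<forall>i<Suc n. \<pi> i \<cdot> k = f i)"
        then have "\<rho> i \<cdot> (u \<cdot> k) = \<rho> i \<cdot> a" if "i < n" for i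
          using assoc_\<rho>[OF that, of k W] a(2) that by simp
        then have "u \<cdot> k = a" using ext[of "u \<cdot> k" W a] k u a(1) by (simp add: hom_iff)
        then show "k = h" using product_ext[OF P, of k W h] k h by simp
      qed
    qed
  }
qed

lemma finite_product_exists:
  assumes "\<And>i. i < n \<Longrightarrow> X i \<in> Obj C"
  shows "\<exists>Q \<rho>. is_finite_product C n X Q \<rho>"
  using assms
proof (induction n)
  case 0
  then show ?case using terminal_T by (auto simp: is_finite_product_def is_terminal_def intro!: exI[of _ T])
next
  case (Suc n)
  then obtain Q \<rho> where Q: "is_finite_product C n X Q \<rho>" by auto
  then have "Q \<in> Obj C" by (simp add: is_finite_product_def)
  then obtain P u v where P: "is_binary_product C Q (X n) P u v"
    using product_exists Suc.prems by blast
  then have "is_finite_product C (Suc n) X P (\<lambda>i. if i < n then \<rho> i \<cdot> u else v)"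
    by (subst finite_product_Suc_iff[OF Q, of u]) (auto simp: is_binary_product_def)
  then show ?case by blast
qed

lemma product_iso:
  assumes Q: "is_binary_product C X Y Q r s" and i: "is_iso C i" "i \<in> hom C P Q"
  shows "is_binary_product C X Y P (r \<cdot> i) (s \<cdot> i)"
proof -
  note D = productD[OF Q]
  obtain j where j: "j \<in> hom C Q P" "j \<cdot> i = Id C P" "i \<cdot> j = Id C Q"
    using i by (auto simp: is_iso_def hom_iff)
  show ?thesis unfolding is_binary_product_def
  proof (intro conjI allI ballI)
    show "r \<cdot> i \<in> hom C P X" "s \<cdot> i \<in> hom C P Y" using i D by (auto simp: hom_iff)
    fix W f g assume "f \<in> hom C W X" "g \<in> hom C W Y"
    then obtain h where h: "h \<in> hom C W Q" "r \<cdot> h = f" "s \<cdot> h = g" using product_pair[OF Q] by blast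
    have ij: "i \<cdot> (j \<cdot> h) = h"
      using Comp_Comp_eq[OF j(3), of h] h i j(1) by (simp add: hom_iff)
    show "\<exists>!h. h \<in> hom C W P \<and> (r \<cdot> i) \<cdot> h = f \<and> (s \<cdot> i) \<cdot> h = g"
    proof (rule ex1I[of _ "j \<cdot> h"])
      show "j \<cdot> h \<in> hom C W P \<and> (r \<cdot> i) \<cdot> (j \<cdot> h) = f \<and> (s \<cdot> i) \<cdot> (j \<cdot> h) = g"
        using i(2) j(1) h ij D by (simp add: hom_iff)
      fix k assume k: "k \<in> hom C W P \<and> (r \<cdot> i) \<cdot> k = f \<and> (s \<cdot> i) \<cdot> k = g"
      then have "i \<cdot> k = h"
        using i(2) h D by (intro product_ext[OF Q, of "i \<cdot> k" W h]) (auto simp: hom_iff)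
      then show "k = j \<cdot> h"
        using Comp_Comp_eq[OF j(2), of k] k i(2) j(1) by (simp add: hom_iff)
    qed
  qed
qed

end

context category
begin

section \<open>The full subcategory of decidable objects\<close>

lemma Dec_simps [simp]:
  "Obj (Dec C) = {X \<in> Obj C. decidable C X}"
  "Dom (Dec C) = Dom C" "Cod (Dec C) = Cod C" "Id (Dec C) = Id C" "Comp (Dec C) = Comp C"
  "Arr (Dec C) = {f \<in> Arr C. decidable C (Dom C f) \<and> decidable C (Cod C f)}"
  by (auto simp: Dec_def full_subcategory_def)

lemma hom_Dec_iff:
  "f \<in> hom (Dec C) X Y \<longleftrightarrow> f \<in> hom C X Y \<and> decidable C X \<and> decidable C Y"
  by (auto simp: hom_def)

lemma category_Dec: "category (Dec C)"
proof
  show "g \<cdot>\<^bsub>Dec C\<^esub> f \<in> hom (Dec C) X Z"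
    if "f \<in> hom (Dec C) X Y" "g \<in> hom (Dec C) Y Z" for f g X Y Z
    using that Comp_in_hom by (auto simp: hom_Dec_iff)
qed (auto simp: hom_Dec_iff hom_iff)

lemma finite_product_Dec:
  assumes "is_finite_product C n X P \<pi>" "decidable C P" "\<And>i. i < n \<Longrightarrow> decidable C (X i)"
  shows "is_finite_product (Dec C) n X P \<pi>"
  unfolding is_finite_product_def
proof (intro conjI allI ballI impI)
  fix W f assume "W \<in> Obj (Dec C)" "\<forall>i<n. f i \<in> hom (Dec C) W (X i)"
  then have W: "W \<in> Obj C" "decidable C W" and f: "\<forall>i<n. f i \<in> hom C W (X i)"
    by (auto simp: hom_Dec_iff)
  have "\<exists>!h. h \<in> hom C W P \<and> (\<forall>i<n. \<pi> i \<cdot> h = f i)"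
    using finite_product_ex1[OF assms(1) W(1), of f] f by simp
  then show "\<exists>!h. h \<in> hom (Dec C) W P \<and> (\<forall>i<n. \<pi> i \<cdot>\<^bsub>Dec C\<^esub> h = f i)"
    using W(2) assms(2) by (simp add: hom_Dec_iff)
qed (use assms in \<open>auto simp: is_finite_product_def hom_Dec_iff\<close>)

end

section \<open>The reflection onto decidable objects\<close>

locale quotients = topos C T \<Omega> tr
  for C :: "('o, 'm) category_data" (structure) and T \<Omega> tr +
  fixes \<Pi> :: "'o \<Rightarrow> 'o" and p :: "'o \<Rightarrow> 'm"
  assumes NS: "NS C"
    and DQO: "DQO C"
    and quotient: "X \<in> Obj C \<Longrightarrow> is_decidable_quotient C X (\<Pi> X) (p X)"
begin

lemma decidable_Pi: "X \<in> Obj C \<Longrightarrow> decidable C (\<Pi> X)"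
  using decidable_quotientD(1)[OF quotient] .

lemma p_Arr [simp]:
  assumes "X \<in> Obj C"
  shows "p X \<in> Arr C" "Dom C (p X) = X" "Cod C (p X) = \<Pi> X"
  using decidable_quotientD(2)[OF quotient[OF assms]] by (auto simp: hom_iff)

lemma Pi_Obj [simp]: "X \<in> Obj C \<Longrightarrow> \<Pi> X \<in> Obj C"
  using decidable_Pi decidable_Obj by blast

lemma p_epi: "X \<in> Obj C \<Longrightarrow> is_epi C (p X)"
  using decidable_quotientD(3)[OF quotient] .

lemma p_universal:
  assumes "f \<in> hom C X D" "decidable C D"
  shows "\<exists>!g. g \<in> hom C (\<Pi> X) D \<and> g \<cdot> p X = f"
  using decidable_quotient_universal[OF DQO quotient assms(2,1)] hom_objs[OF assms(1)] by blast

text \<open>The identity of \<open>B\<close> is an arrow into 2 and so factors through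
  \<open>p B\<close>. Hence \<open>p B\<close> is a split mono and \<open>B\<close> a subobject of
  the decidable \<open>\<Pi> B\<close>.\<close>

lemma decidable_two:
  assumes "is_two C B"
  shows "decidable C B"
proof -
  obtain S i j where "is_binary_coproduct C S S B i j" using assms unfolding is_two_def by blast
  then have "i \<in> hom C S B" by (simp add: is_binary_coproduct_def)
  then have B: "B \<in> Obj C" using hom_objs by blast
  obtain g where g: "g \<in> hom C (\<Pi> B) B" "g \<cdot> p B = Id C B"
    using quotient[OF B] assms Id_in_hom[OF B] unfolding is_decidable_quotient_def by blast
  have "is_mono C (p B)"
    by (rule split_mono[of g]) (use g B in \<open>auto simp: hom_iff\<close>)
  then show ?thesis
    using decidable_mono[of "p B" B "\<Pi> B"] decidable_Pi[OF B] B by (simp add: hom_iff)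
qed

lemma two_point_eq:
  assumes B: "is_two C B" and f: "f \<in> hom C X B" and x: "x \<in> hom C W X" "y \<in> hom C W X"
    and eq: "p X \<cdot> x = p X \<cdot> y"
  shows "f \<cdot> x = f \<cdot> y"
proof -
  have X: "X \<in> Obj C" using f hom_objs by blast
  obtain g where g: "g \<in> hom C (\<Pi> X) B" "g \<cdot> p X = f"
    using p_universal[OF f decidable_two[OF B]] by blast
  have "f \<cdot> z = g \<cdot> (p X \<cdot> z)" if "z \<in> hom C W X" for z
    using g that X by (auto simp: hom_iff)
  then show ?thesis using x eq by simp
qed

text \<open>By (NS) it suffices to compare two points \<open>u\<close> and \<open>v\<close> of \<open>P = X \<times> Y\<close> with the same image in
  \<open>\<Pi> X \<times> \<Pi> Y\<close>, and those can be compared one coordinate at a time.\<close>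

lemma product_quotient:
  assumes P: "is_binary_product C X Y P r s" and Q: "is_binary_product C (\<Pi> X) (\<Pi> Y) Q r' s'"
    and k: "k \<in> hom C P Q" "r' \<cdot> k = p X \<cdot> r" "s' \<cdot> k = p Y \<cdot> s"
  shows "is_decidable_quotient C P Q k"
proof -
  note D = productD[OF P] productD[OF Q]
  have k_epi: "is_epi C k"
    by (rule epi_product[OF p_epi[OF D(7)] _ p_epi[OF D(8)] _ P Q k]) (use D in \<open>auto simp: hom_iff\<close>)
  have points: "f \<cdot> u = f \<cdot> v"
    if B: "is_two C B" and f: "f \<in> hom C P B" and uv: "u \<in> hom C T P" "v \<in> hom C T P" "k \<cdot> u = k \<cdot> v"
    for B f u v
  proof -
    have coords: "p X \<cdot> (r \<cdot> u) = p X \<cdot> (r \<cdot> v)" "p Y \<cdot> (s \<cdot> u) = p Y \<cdot> (s \<cdot> v)"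
      using Comp_square[OF k(2), of u] Comp_square[OF k(2), of v]
        Comp_square[OF k(3), of u] Comp_square[OF k(3), of v] uv k(1) D
      by (simp_all add: hom_iff)
    have pts: "r \<cdot> u \<in> hom C T X" "r \<cdot> v \<in> hom C T X" "s \<cdot> u \<in> hom C T Y" "s \<cdot> v \<in> hom C T Y"
      using uv D by (auto simp: hom_iff)
    have cX: "(s \<cdot> u) \<cdot> bang X \<in> hom C X Y" "(r \<cdot> v) \<cdot> bang Y \<in> hom C Y X"
      using pts D by (auto simp: hom_iff)
    obtain w where w: "w \<in> hom C T P" "r \<cdot> w = r \<cdot> v" "s \<cdot> w = s \<cdot> u"
      using product_pair[OF P pts(2,3)] by blast
    \<comment> \<open>\<open>j\<close> and \<open>l\<close> embed the slices
      \<open>X \<times> {s u}\<close> and \<open>{r v} \<times> Y\<close>. The points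
      \<open>u\<close> and \<open>w\<close> lie on the first, \<open>w\<close> and \<open>v\<close>
      on the second.\<close>
    obtain j where j: "j \<in> hom C X P" "r \<cdot> j = Id C X" "s \<cdot> j = (s \<cdot> u) \<cdot> bang X"
      using product_pair[OF P Id_in_hom[OF D(7)] cX(1)] by blast
    obtain l where l: "l \<in> hom C Y P" "r \<cdot> l = (r \<cdot> v) \<cdot> bang Y" "s \<cdot> l = Id C Y"
      using product_pair[OF P cX(2) Id_in_hom[OF D(8)]] by blast
    have bangT: "bang A \<cdot> z = Id C T" if "z \<in> hom C T A" for z A
      using that hom_objs[OF that] by (intro to_T_eq[of _ T]) (auto simp: hom_iff)
    have jz: "j \<cdot> z = t" if z: "z \<in> hom C T X" and t: "t \<in> hom C T P" "r \<cdot> t = z" "s \<cdot> t = s \<cdot> u" for z t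
    proof (rule product_ext[OF P, of _ T])
      show "r \<cdot> (j \<cdot> z) = r \<cdot> t" using Comp_Comp_eq[OF j(2), of z] j(1) z t D by (simp add: hom_iff)
      show "s \<cdot> (j \<cdot> z) = s \<cdot> t"
        using Comp_square[OF j(3), of z] j(1) z t bangT[OF z] pts(3) D by (simp add: hom_iff)
    qed (use j(1) z t in \<open>auto simp: hom_iff\<close>)
    have lz: "l \<cdot> z = t" if z: "z \<in> hom C T Y" and t: "t \<in> hom C T P" "r \<cdot> t = r \<cdot> v" "s \<cdot> t = z" for z t
    proof (rule product_ext[OF P, of _ T])
      show "r \<cdot> (l \<cdot> z) = r \<cdot> t"
        using Comp_square[OF l(2), of z] l(1) z t bangT[OF z] pts(2) D by (simp add: hom_iff)
      show "s \<cdot> (l \<cdot> z) = s \<cdot> t" using Comp_Comp_eq[OF l(3), of z] l(1) z t D by (simp add: hom_iff)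
    qed (use l(1) z t in \<open>auto simp: hom_iff\<close>)
    have "f \<cdot> j \<in> hom C X B" "f \<cdot> l \<in> hom C Y B" using f j(1) l(1) by (auto simp: hom_iff)
    note this[THEN two_point_eq[OF B]]
    from this(1)[OF pts(1,2) coords(1)] this(2)[OF pts(3,4) coords(2)]
    have "f \<cdot> (j \<cdot> (r \<cdot> u)) = f \<cdot> (j \<cdot> (r \<cdot> v))" "f \<cdot> (l \<cdot> (s \<cdot> u)) = f \<cdot> (l \<cdot> (s \<cdot> v))"
      using f j(1) l(1) pts by (simp_all add: hom_iff)
    then show ?thesis
      using jz[OF pts(1) uv(1)] jz[OF pts(2) w] lz[OF pts(3) w] lz[OF pts(4) uv(2)] by simp
  qed
  have factor: "\<exists>g. g \<in> hom C Q B \<and> g \<cdot> k = f" if B: "is_two C B" and f: "f \<in> hom C P B" for B f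
  proof -
    \<comment> \<open>\<open>epi_factor\<close> asks for agreement at every stage, while
      \<open>points\<close> covers global elements; \<open>points_separate\<close> at stage
      \<open>Dom C a\<close> closes the gap.\<close>
    have "f \<cdot> a = f \<cdot> b"
      if ab: "a \<in> into P" "b \<in> into P" "Dom C a = Dom C b" "k \<cdot> a = k \<cdot> b" for a b
    proof (rule points_separate[OF NS decidable_two[OF B], of _ "Dom C a"])
      show "f \<cdot> a \<in> hom C (Dom C a) B" "f \<cdot> b \<in> hom C (Dom C a) B"
        using ab f by (auto simp: hom_iff into_iff)
      fix x assume x: "x \<in> hom C T (Dom C a)"
      have "k \<cdot> (a \<cdot> x) = k \<cdot> (b \<cdot> x)"
        using Comp_square[OF ab(4), of x] ab(1-3) x k(1) by (simp add: hom_iff into_iff)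
      then have "f \<cdot> (a \<cdot> x) = f \<cdot> (b \<cdot> x)"
        using ab x by (intro points[OF B f]) (auto simp: hom_iff into_iff)
      then show "(f \<cdot> a) \<cdot> x = (f \<cdot> b) \<cdot> x"
        using ab(1-3) x f by (simp add: hom_iff into_iff)
    qed
    then show ?thesis using epi_factor[OF k_epi k(1) f] by blast
  qed
  show ?thesis unfolding is_decidable_quotient_def
  proof (intro conjI allI impI ballI)
    show "decidable C Q" using decidable_product[OF Q] decidable_Pi D by blast
    fix B f assume B: "is_two C B" and f: "f \<in> hom C P B"
    then obtain g where g: "g \<in> hom C Q B" "g \<cdot> k = f" using factor by blast
    show "\<exists>!g. g \<in> hom C Q B \<and> g \<cdot> k = f"
    proof (rule ex1I[of _ g])
      show "h = g" if "h \<in> hom C Q B \<and> h \<cdot> k = f" for h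
        using that g epiD[OF k_epi, of h g B] k(1) by (simp add: hom_iff)
    qed (use g in simp)
  qed (use k k_epi in auto)
qed

section \<open>Functoriality and preservation of products\<close>

definition Pi_arr :: "'m \<Rightarrow> 'm" where
  "Pi_arr f = (THE g. g \<in> hom C (\<Pi> (Dom C f)) (\<Pi> (Cod C f)) \<and> g \<cdot> p (Dom C f) = p (Cod C f) \<cdot> f)"

lemma Pi_arr_ex1:
  assumes "f \<in> Arr C"
  shows "\<exists>!g. g \<in> hom C (\<Pi> (Dom C f)) (\<Pi> (Cod C f)) \<and> g \<cdot> p (Dom C f) = p (Cod C f) \<cdot> f"
  using assms by (intro p_universal decidable_Pi) (auto simp: hom_iff)

lemma Pi_arr:
  assumes "f \<in> hom C X Y"
  shows "Pi_arr f \<in> hom C (\<Pi> X) (\<Pi> Y)" "Pi_arr f \<cdot> p X = p Y \<cdot> f"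
  using theI'[OF Pi_arr_ex1[of f]] assms unfolding Pi_arr_def[symmetric] by (auto simp: hom_iff)

lemma Pi_arr_eqI:
  assumes "f \<in> hom C X Y" "g \<in> hom C (\<Pi> X) (\<Pi> Y)" "g \<cdot> p X = p Y \<cdot> f"
  shows "Pi_arr f = g"
  using Pi_arr_ex1[of f] Pi_arr[OF assms(1)] assms by (auto simp: hom_iff)

lemma Pi_arr_Comp:
  assumes "f \<in> hom C X Y" "g \<in> hom C Y Z"
  shows "Pi_arr (g \<cdot> f) = Pi_arr g \<cdot> Pi_arr f"
proof (rule Pi_arr_eqI[of _ X Z])
  note F = Pi_arr[OF assms(1)] and G = Pi_arr[OF assms(2)]
  have O: "X \<in> Obj C" "Y \<in> Obj C" "Z \<in> Obj C" using assms hom_objs by blast+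
  show "g \<cdot> f \<in> hom C X Z" "Pi_arr g \<cdot> Pi_arr f \<in> hom C (\<Pi> X) (\<Pi> Z)"
    using assms F G by (auto simp: hom_iff)
  show "Pi_arr g \<cdot> Pi_arr f \<cdot> p X = p Z \<cdot> (g \<cdot> f)"
    using Comp_square[OF G(2), of f] F G(1) assms O by (simp add: hom_iff)
qed

lemma is_functor_Pi_arr: "is_functor C (Dec C) \<Pi> Pi_arr"
  unfolding is_functor_def
proof (intro conjI allI ballI)
  show "category C" "category (Dec C)" by (rule category_axioms, rule category_Dec)
  show "\<Pi> X \<in> Obj (Dec C)" if "X \<in> Obj C" for X using that decidable_Pi by simp
  show "Pi_arr f \<in> hom (Dec C) (\<Pi> X) (\<Pi> Y)" if "f \<in> hom C X Y" for X Y f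
    using Pi_arr(1)[OF that] hom_objs[OF that] decidable_Pi by (simp add: hom_Dec_iff)
  show "Pi_arr (Id C X) = Id (Dec C) (\<Pi> X)" if "X \<in> Obj C" for X
    using that by (intro Pi_arr_eqI[of _ X X, THEN trans]) (auto simp: hom_iff)
  show "Pi_arr (g \<cdot> f) = Pi_arr g \<cdot>\<^bsub>Dec C\<^esub> Pi_arr f" if "f \<in> hom C X Y" "g \<in> hom C Y Z" for X Y Z f g
    using Pi_arr_Comp[OF that] by simp
qed

text \<open>By \<open>product_quotient\<close>, the product \<open>Q\<close> of the quotients is
  itself a decidable quotient of \<open>P\<close>. Uniqueness in (DQO) identifies it with
  \<open>\<Pi> P\<close> under \<open>P\<close>, and the product structure is carried along that
  isomorphism.\<close>

lemma binary_product_Pi: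
  assumes P: "is_binary_product C X Y P r s"
  shows "is_binary_product C (\<Pi> X) (\<Pi> Y) (\<Pi> P) (Pi_arr r) (Pi_arr s)"
proof -
  note D = productD[OF P]
  obtain Q r' s' where Q: "is_binary_product C (\<Pi> X) (\<Pi> Y) Q r' s'"
    using product_exists[of "\<Pi> X" "\<Pi> Y"] D by auto
  note DQ = productD[OF Q]
  have "p X \<cdot> r \<in> hom C P (\<Pi> X)" "p Y \<cdot> s \<in> hom C P (\<Pi> Y)" using D by (auto simp: hom_iff)
  then obtain k where k: "k \<in> hom C P Q" "r' \<cdot> k = p X \<cdot> r" "s' \<cdot> k = p Y \<cdot> s"
    by (rule product_pair[OF Q])
  obtain i where i: "i \<in> hom C (\<Pi> P) Q" "is_iso C i" "i \<cdot> p P = k"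
    using DQO D(9) quotient[OF D(9)] product_quotient[OF P Q k] unfolding DQO_def by blast
  \<comment> \<open>Composing with \<open>p P\<close> gives \<open>r' k = p X \<cdot> r\<close>, the
    equation that determines \<open>Pi_arr r\<close>; likewise for \<open>s\<close>.\<close>
  have "Pi_arr r = r' \<cdot> i" "Pi_arr s = s' \<cdot> i"
    by (rule Pi_arr_eqI[of r P X], use i k D DQ in \<open>simp_all add: hom_iff\<close>)
      (rule Pi_arr_eqI[of s P Y], use i k D DQ in \<open>simp_all add: hom_iff\<close>)
  then show ?thesis using product_iso[OF Q i(2,1)] by simp
qed

text \<open>A terminal object is decidable, so its identity factors through \<open>p P\<close>;
  being also epi, \<open>p P\<close> is invertible.\<close>

lemma terminal_Pi:
  assumes P: "is_terminal C P"
  shows "is_terminal C (\<Pi> P)"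
proof -
  have O: "P \<in> Obj C" using P by (simp add: is_terminal_def)
  obtain g where g: "g \<in> hom C (\<Pi> P) P" "g \<cdot> p P = Id C P"
    using p_universal[OF Id_in_hom[OF O] decidable_terminal[OF P]] by blast
  have pg: "p P \<cdot> g = Id C (\<Pi> P)"
    by (rule epiD[OF p_epi[OF O], of _ _ "\<Pi> P"]) (use g O in \<open>auto simp: hom_iff\<close>)
  show ?thesis unfolding is_terminal_def
  proof (intro conjI ballI)
    fix W assume W: "W \<in> Obj C"
    then obtain h where h: "h \<in> hom C W P" using P unfolding is_terminal_def by blast
    show "\<exists>!f. f \<in> hom C W (\<Pi> P)"
    proof (rule ex1I[of _ "p P \<cdot> h"])
      show "p P \<cdot> h \<in> hom C W (\<Pi> P)" using h O by (simp add: hom_iff)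
      fix f assume f: "f \<in> hom C W (\<Pi> P)"
      have "g \<cdot> f \<in> hom C W P" using f g by (simp add: hom_iff)
      then have "g \<cdot> f = h" using P W h unfolding is_terminal_def by blast
      then show "f = p P \<cdot> h"
        using Comp_Comp_eq[OF pg, of f] f g(1) O by (simp add: hom_iff)
    qed
  qed (use O in simp)
qed

text \<open>The given \<open>P\<close> need not be an iterated product. A product \<open>Q\<close>
  of the first \<open>n\<close> factors is therefore chosen, and \<open>P\<close> is recognised as a
  binary product of \<open>Q\<close> with the last factor.\<close>

lemma finite_product_Pi:
  assumes "is_finite_product C n X P \<pi>"
  shows "is_finite_product C n (\<lambda>i. \<Pi> (X i)) (\<Pi> P) (\<lambda>i. Pi_arr (\<pi> i))"
  using assms
proof (induction n arbitrary: P \<pi>)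
  case 0
  then have "is_terminal C P" by (simp add: is_finite_product_def is_terminal_def)
  then show ?case using terminal_Pi[of P] by (simp add: is_finite_product_def is_terminal_def)
next
  case (Suc n)
  have \<pi>: "\<pi> i \<in> hom C P (X i)" if "i < Suc n" for i
    using Suc.prems that by (simp add: is_finite_product_def)
  have "X i \<in> Obj C" if "i < n" for i using \<pi>[of i] that hom_objs by auto
  then obtain Q \<rho> where Q: "is_finite_product C n X Q \<rho>" using finite_product_exists by blast
  have "P \<in> Obj C" using Suc.prems by (simp add: is_finite_product_def)
  then obtain u where u: "u \<in> hom C P Q" "\<And>i. i < n \<Longrightarrow> \<rho> i \<cdot> u = \<pi> i"
    using finite_product_ex1[OF Q, of P \<pi>] \<pi> by auto
  have "is_binary_product C Q (X n) P u (\<pi> n)"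
    using finite_product_Suc_iff[OF Q u(1), of \<pi>] Suc.prems u(2) by simp
  then have "is_binary_product C (\<Pi> Q) (\<Pi> (X n)) (\<Pi> P) (Pi_arr u) (Pi_arr (\<pi> n))"
    by (rule binary_product_Pi)
  moreover have "Pi_arr (\<pi> i) = Pi_arr (\<rho> i) \<cdot> Pi_arr u" if "i < n" for i
  proof -
    have "\<rho> i \<in> hom C Q (X i)" using Q that by (simp add: is_finite_product_def)
    then show ?thesis using Pi_arr_Comp[OF u(1), of "\<rho> i" "X i"] u(2)[OF that] by simp
  qed
  ultimately show ?case
    using finite_product_Suc_iff[OF Suc.IH[OF Q] Pi_arr(1)[OF u(1)], of "\<lambda>i. Pi_arr (\<pi> i)"] by simp
qed

lemma preserves_finite_products_Pi: "preserves_finite_products C (Dec C) \<Pi> Pi_arr"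
  unfolding preserves_finite_products_def
proof (intro allI impI)
  fix n X P \<pi> assume P: "is_finite_product C n X P \<pi>"
  then have "P \<in> Obj C" "\<And>i. i < n \<Longrightarrow> X i \<in> Obj C"
    using hom_objs unfolding is_finite_product_def by blast+
  then show "is_finite_product (Dec C) n (\<lambda>i. \<Pi> (X i)) (\<Pi> P) (\<lambda>i. Pi_arr (\<pi> i))"
    using decidable_Pi by (intro finite_product_Dec finite_product_Pi P) auto
qed

text \<open>The unit is \<open>p\<close>. Composition with \<open>p X\<close> is injective because
  \<open>p X\<close> is epi and surjective by \<open>p_universal\<close>; naturality is the square
  defining \<open>Pi_arr\<close>.\<close>

lemma is_left_adjoint_Pi: "is_left_adjoint C (Dec C) \<Pi> Pi_arr (\<lambda>X. X) (\<lambda>f. f)"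
  unfolding is_left_adjoint_def
proof (intro conjI exI[of _ "\<lambda>X Y g. g \<cdot> p X"] ballI allI)
  show "is_functor C (Dec C) \<Pi> Pi_arr" by (rule is_functor_Pi_arr)
  show "is_functor (Dec C) C (\<lambda>X. X) (\<lambda>f. f)"
    using category_axioms category_Dec by (auto simp: is_functor_def hom_Dec_iff)
  fix X Y assume X: "X \<in> Obj C" and Y: "Y \<in> Obj (Dec C)"
  then have dY: "decidable C Y" by simp
  show "bij_betw (\<lambda>g. g \<cdot> p X) (hom (Dec C) (\<Pi> X) Y) (hom C X Y)"
    unfolding bij_betw_def
  proof
    show "inj_on (\<lambda>g. g \<cdot> p X) (hom (Dec C) (\<Pi> X) Y)"
    proof (rule inj_onI)
      fix g h assume "g \<in> hom (Dec C) (\<Pi> X) Y" "h \<in> hom (Dec C) (\<Pi> X) Y" "g \<cdot> p X = h \<cdot> p X"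
      then show "g = h" using epiD[OF p_epi[OF X], of g h Y] X by (simp add: hom_Dec_iff)
    qed
    show "(\<lambda>g. g \<cdot> p X) ` hom (Dec C) (\<Pi> X) Y = hom C X Y"
    proof (intro set_eqI iffI)
      fix f assume "f \<in> hom C X Y"
      then obtain g where "g \<in> hom C (\<Pi> X) Y" "g \<cdot> p X = f" using p_universal[OF _ dY] by blast
      then show "f \<in> (\<lambda>g. g \<cdot> p X) ` hom (Dec C) (\<Pi> X) Y"
        using dY decidable_Pi[OF X] by (auto simp: hom_Dec_iff)
    qed (use X in \<open>auto simp: hom_Dec_iff hom_iff\<close>)
  qed
next
  fix X X' Y Y' a b f
  assume a: "a \<in> hom C X' X" and "b \<in> hom (Dec C) Y Y'" "f \<in> hom (Dec C) (\<Pi> X) Y"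
  then have bf: "b \<in> hom C Y Y'" "f \<in> hom C (\<Pi> X) Y" and O: "X \<in> Obj C" "X' \<in> Obj C"
    using hom_objs[OF a] by (auto simp: hom_Dec_iff)
  show "(b \<cdot>\<^bsub>Dec C\<^esub> f \<cdot>\<^bsub>Dec C\<^esub> Pi_arr a) \<cdot> p X' = b \<cdot> (f \<cdot> p X) \<cdot> a"
    using a bf O Pi_arr[OF a] by (simp add: hom_iff)
qed

end


theorem theoremA:
  fixes E :: "('o, 'm) category_data"
    and \<Pi> :: "'o \<Rightarrow> 'o"
    and p :: "'o \<Rightarrow> 'm"
  assumes topos: "elementary_topos E"
    and NS: "NS E"
    and DQO: "DQO E"
    and quotient: "\<And>X. X \<in> Obj E \<Longrightarrow> is_decidable_quotient E X (\<Pi> X) (p X)"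
  shows "\<exists>\<Pi>\<^sub>a :: 'm \<Rightarrow> 'm.
    is_functor E (Dec E) \<Pi> \<Pi>\<^sub>a \<and>
    preserves_finite_products E (Dec E) \<Pi> \<Pi>\<^sub>a \<and>
    is_left_adjoint E (Dec E) \<Pi> \<Pi>\<^sub>a (\<lambda>X. X) (\<lambda>f. f)"
proof -
  obtain T \<Omega> tr where "topos E T \<Omega> tr"
    using topos unfolding elementary_topos_def by (metis topos.intro topos_axioms.intro)
  then interpret quotients E T \<Omega> tr \<Pi> p
    using NS DQO quotient by (intro quotients.intro quotients_axioms.intro)
  show ?thesis
    using is_functor_Pi_arr preserves_finite_products_Pi is_left_adjoint_Pi by blast
qed

end
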